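(* Let $p\in\Delta=\mathbb{R}\setminus(0,1)$ with $p\neq 2$, and put $\alpha=1+(1-p)^{-1}$, with the convention that $p=1$ corresponds to $\alpha=-\infty$. Let $X=\{X(\mu;t):\mu\in\overline{\Omega},t\ge 0\}$ be an exponential family of Lévy processes. Then $X$ is self-similar with Hurst exponent $$H=\frac1\alpha$$ (with the convention that $\alpha=-\infty$ corresponds to $H=0$) if and only if $X$ has power variance function with power $p$, that is, if and only if $X$ is a family of Hougaard Lévy processes $S_p(\mu;\cdot)$ with power parameter $p$.
   Context: Families of processes: $X=\{X(\mu;t):\mu\in\overline\Omega,t\ge0\}$ is a family of real-valued stochastic processes on a common probability space, where $\overline\Omega$ is an interval (possibly containing $\pm\infty$) with $\mathbb{R}_+\subseteq\overline\Omega$ and $c\,\overline\Omega\subseteq\overline\Omega$ for all $c>0$; $\Omega$ is the interior of $\overline\Omega$. Self-similarity: $X$ is self-similar with Hurst exponent $H\in\mathbb{R}$ if for all $c>0$ and $\mu\in\overline\Omega$, the processes $\{X(\mu c^{H-1};ct)\}_{t\ge0}$ and $\{c^HX(\mu;t)\}_{t\ge0}$ have the same finite-dimensional distributions. Exponential family of Lévy processes: each $X(\mu;\cdot)$ is a Lévy process (started at $0$), and the distributions of $X(\mu;1)$, $\mu\in\overline\Omega$, form a full natural exponential family parametrized by its mean $\mu$. That is, they are the measures $e^{\theta x-\kappa(\theta)}P(dx)$, $\theta\in\Theta$, where $P$ is a non-degenerate probability measure with cumulant generating function $\kappa(\theta)=\log\int e^{\theta x}P(dx)$, $\Theta=\{\theta:\kappa(\theta)<\infty\}$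 has non-empty interior, $\mu=\dot\kappa(\theta)$ and $\overline\Omega=\dot\kappa(\Theta)$ (at endpoints of $\Theta$, $\dot\kappa$ is the one-sided limit, possibly $\pm\infty$). Hence $\mathbb{E}[X(\mu;t)]=\mu t$ and $\mathrm{Var}[X(\mu;t)]=tV(\mu)$ for $\mu\in\Omega$, where $V(\mu)=\mathrm{Var}[X(\mu;1)]=\ddot\kappa(\dot\kappa^{-1}(\mu))$ is the variance function. Power variance function with power $p$: $V(\mu)=\sigma^2\mu^p$ on $\Omega$ for some $\sigma^2>0$, where $\Omega=\mathbb{R}$ if $p=0$ and $\Omega=\mathbb{R}_+=(0,\infty)$ if $p\ne0$. A family of Hougaard Lévy processes $S_p(\mu;t)$ is by definition an exponential family of Lévy processes with power variance function with power $p$; such families exist exactly for $p\in\Delta$, with $\overline\Omega=\overline\Omega_p$ equal to $[0,\infty)$ for $p<0$, $\mathbb{R}$ for $p=0$, $(0,\infty)$ for $1\le p\le2$, and $(0,\infty]$ for $p>2$. *)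

theory Defs
  imports "HOL-Probability.Probability"
begin

text \<open>A family of processes is represented by \<open>X :: ereal \<Rightarrow> real \<Rightarrow> 'a \<Rightarrow> real\<close>, where \<open>X \<mu> t\<close> is
  relevant only for \<open>\<mu>\<close> in the parameter set \<open>Obar\<close> and \<open>t \<ge> 0\<close>.\<close>

definition family_domain :: "ereal set \<Rightarrow> bool" where
  "family_domain Obar \<longleftrightarrow>
     (\<forall>x\<in>Obar. \<forall>y\<in>Obar. {x..y} \<subseteq> Obar) \<and>
     ereal ` {0<..} \<subseteq> Obar \<and>
     (\<forall>c::real. c > 0 \<longrightarrow> (\<lambda>x. ereal c * x) ` Obar \<subseteq> Obar)"

text \<open>The interior is taken in the real line: in \<open>ereal\<close> an infinite endpoint
  would be an interior point.\<close>

definition domain_interior :: "ereal set \<Rightarrow> real set" where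
  "domain_interior Obar = interior {x. ereal x \<in> Obar}"

definition same_fdd ::
  "'a measure \<Rightarrow> (real \<Rightarrow> 'a \<Rightarrow> real) \<Rightarrow> (real \<Rightarrow> 'a \<Rightarrow> real) \<Rightarrow> bool" where
  "same_fdd M Y Z \<longleftrightarrow>
     (\<forall>J. finite J \<longrightarrow> J \<subseteq> {0..} \<longrightarrow>
        distr M (Pi\<^sub>M J (\<lambda>_. borel)) (\<lambda>\<omega>. \<lambda>t\<in>J. Y t \<omega>) =
        distr M (Pi\<^sub>M J (\<lambda>_. borel)) (\<lambda>\<omega>. \<lambda>t\<in>J. Z t \<omega>))"

definition self_similar ::
  "'a measure \<Rightarrow> ereal set \<Rightarrow> (ereal \<Rightarrow> real \<Rightarrow> 'a \<Rightarrow> real) \<Rightarrow> real \<Rightarrow> bool" where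
  "self_similar M Obar X H \<longleftrightarrow>
     (\<forall>c>0. \<forall>\<mu>\<in>Obar.
        same_fdd M
          (\<lambda>t. X (\<mu> * ereal (c powr (H - 1))) (c * t))
          (\<lambda>t \<omega>. c powr H * X \<mu> t \<omega>))"

text \<open>Right-continuity of paths is not required, only continuity in probability.\<close>

definition levy_process :: "'a measure \<Rightarrow> (real \<Rightarrow> 'a \<Rightarrow> real) \<Rightarrow> bool" where
  "levy_process M Y \<longleftrightarrow>
     (\<forall>t\<ge>0. Y t \<in> borel_measurable M) \<and>
     (AE \<omega> in M. Y 0 \<omega> = 0) \<and>
     (\<forall>(n::nat) t. 0 \<le> t 0 \<longrightarrow> (\<forall>i<n. t i \<le> t (Suc i)) \<longrightarrow>
        prob_space.indep_vars M (\<lambda>_. borel) (\<lambda>i \<omega>. Y (t (Suc i)) \<omega> - Y (t i) \<omega>) {..<n}) \<and>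
     (\<forall>s\<ge>0. \<forall>t\<ge>0. distr M borel (\<lambda>\<omega>. Y (s + t) \<omega> - Y s \<omega>) = distr M borel (Y t)) \<and>
     (\<forall>t\<ge>0. \<forall>e>0.
        ((\<lambda>s. measure M {\<omega> \<in> space M. \<bar>Y s \<omega> - Y t \<omega>\<bar> > e}) \<longlongrightarrow> 0) (at t within {0..}))"

text \<open>\<open>cgf P \<theta>\<close> is meaningful only for \<open>\<theta> \<in> cgf_domain P\<close>, the set where the cumulant
  generating function is finite.\<close>

definition cgf :: "real measure \<Rightarrow> real \<Rightarrow> real" where
  "cgf P \<theta> = ln (\<integral>x. exp (\<theta> * x) \<partial>P)"

definition cgf_domain :: "real measure \<Rightarrow> real set" where
  "cgf_domain P = {\<theta>. integrable P (\<lambda>x. exp (\<theta> * x))}"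

text \<open>At an endpoint of the interval \<open>cgf_domain P\<close> the limit along its interior is the
  one-sided limit, taken in \<open>ereal\<close>.\<close>

definition cgf_deriv :: "real measure \<Rightarrow> real \<Rightarrow> ereal" where
  "cgf_deriv P \<theta> =
     (if \<theta> \<in> interior (cgf_domain P) then ereal (deriv (cgf P) \<theta>)
      else Lim (at \<theta> within interior (cgf_domain P)) (\<lambda>s. ereal (deriv (cgf P) s)))"

text \<open>\<open>Q \<mu>\<close>, \<open>\<mu> \<in> Obar\<close>, are the members of the full natural exponential family generated by
  some non-degenerate \<open>P\<close>, indexed by their means.\<close>

definition natural_exponential_family :: "ereal set \<Rightarrow> (ereal \<Rightarrow> real measure) \<Rightarrow> bool" where
  "natural_exponential_family Obar Q \<longleftrightarrow>
     (\<exists>P. prob_space P \<and> sets P = sets borel \<and>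
          \<not> (\<exists>a. AE x in P. x = a) \<and>
          interior (cgf_domain P) \<noteq> {} \<and>
          Obar = cgf_deriv P ` cgf_domain P \<and>
          (\<forall>\<theta>\<in>cgf_domain P.
             Q (cgf_deriv P \<theta>) = density P (\<lambda>x. ennreal (exp (\<theta> * x - cgf P \<theta>)))))"

definition exponential_levy_family ::
  "'a measure \<Rightarrow> ereal set \<Rightarrow> (ereal \<Rightarrow> real \<Rightarrow> 'a \<Rightarrow> real) \<Rightarrow> bool" where
  "exponential_levy_family M Obar X \<longleftrightarrow>
     (\<forall>\<mu>\<in>Obar. levy_process M (X \<mu>)) \<and>
     natural_exponential_family Obar (\<lambda>\<mu>. distr M borel (X \<mu> 1))"

definition variance_function ::
  "'a measure \<Rightarrow> (ereal \<Rightarrow> real \<Rightarrow> 'a \<Rightarrow> real) \<Rightarrow> real \<Rightarrow> real" where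
  "variance_function M X \<mu> = prob_space.variance M (X (ereal \<mu>) 1)"

text \<open>The case distinction in the formula is needed because \<open>0 powr 0 = 0\<close>.\<close>

definition power_variance ::
  "'a measure \<Rightarrow> ereal set \<Rightarrow> (ereal \<Rightarrow> real \<Rightarrow> 'a \<Rightarrow> real) \<Rightarrow> real \<Rightarrow> bool" where
  "power_variance M Obar X p \<longleftrightarrow>
     domain_interior Obar = (if p = 0 then UNIV else {0<..}) \<and>
     (\<exists>\<sigma>2>0. \<forall>\<mu>\<in>domain_interior Obar.
        variance_function M X \<mu> = \<sigma>2 * (if p = 0 then 1 else \<mu> powr p))"

definition hougaard_family ::
  "'a measure \<Rightarrow> ereal set \<Rightarrow> (ereal \<Rightarrow> real \<Rightarrow> 'a \<Rightarrow> real) \<Rightarrow> real \<Rightarrow> bool" where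
  "hougaard_family M Obar X p \<longleftrightarrow>
     exponential_levy_family M Obar X \<and> power_variance M Obar X p"

definition stability_index :: "real \<Rightarrow> ereal" where
  "stability_index p = (if p = 1 then - \<infinity> else ereal (1 + inverse (1 - p)))"

text \<open>In \<open>ereal\<close>, \<open>1 / - \<infinity> = 0\<close>, so \<open>p = 1\<close> gives exponent \<open>0\<close>.\<close>

definition hurst_exponent :: "real \<Rightarrow> real" where
  "hurst_exponent p = real_of_ereal (1 / stability_index p)"

end

theory Submission
  imports Defs "HOL-Complex_Analysis.Complex_Analysis"
begin

text \<open>Write \<open>\<kappa>\<close> for the cumulant function of the generator \<open>P\<close> and \<open>m = \<kappa>'\<close> for the mean map. Self-similarity
  at a single time says that \<open>c (\<kappa>(\<theta>' + s) - \<kappa>(\<theta>')) = \<kappa>(\<theta> + c\<^sup>H s) - \<kappa>(\<theta>)\<close> for \<open>m(\<theta>') = a m(\<theta>)\<close> with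
  \<open>a = c\<^sup>H\<^sup>-\<^sup>1\<close>; differentiating twice at \<open>s = 0\<close> gives \<open>V(a \<mu>) = a\<^sup>p V(\<mu>)\<close>, which determines \<open>V\<close> on the
  positive half-line. The shape of the mean domain then follows from \<open>V(0) > 0\<close> when \<open>0\<close> is a mean,
  and, for \<open>p = 0\<close>, from the fact that a cumulant function that is quadratic on an interval belongs to a
  Gaussian law, whose mean domain is the whole line.

  Conversely, homogeneity of \<open>V = m' \<circ> m\<^sup>-\<^sup>1\<close> forces the parameter map \<open>\<theta> \<mapsto> m\<^sup>-\<^sup>1(a m(\<theta>))\<close> to be affine, so
  the identity for \<open>\<kappa>\<close> above holds globally. Hence the moment generating functions of the
  one-dimensional marginals of both processes are proportional on an open interval, which
  determines the marginals, and a Levy process is determined in law by its marginals.\<close>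

section \<open>Exponential moments\<close>

text \<open>The factor \<open>x ^ k\<close> is carried along because differentiation in
  \<open>z\<close> raises \<open>k\<close> by one, so this family is closed under differentiation.
  The complex argument is what makes analytic continuation off the real axis possible.\<close>

definition exp_moment :: "real measure \<Rightarrow> nat \<Rightarrow> complex \<Rightarrow> complex" where
  "exp_moment P k z = (\<integral>x. complex_of_real (x ^ k) * exp (z * complex_of_real x) \<partial>P)"

definition real_exp_moment :: "real measure \<Rightarrow> nat \<Rightarrow> real \<Rightarrow> real" where
  "real_exp_moment P k \<theta> = (\<integral>x. x ^ k * exp (\<theta> * x) \<partial>P)"

lemma power_div_fact_le_exp:
  fixes y :: real
  assumes "y \<ge> 0"
  shows "y ^ k / fact k \<le> exp y"
proof -
  have "(\<Sum>n\<in>{k}. y ^ n /\<^sub>R fact n) \<le> (\<Sum>n. y ^ n /\<^sub>R fact n)"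
    using assms by (intro sum_le_suminf sums_summable[OF exp_converges]) auto
  also have "\<dots> = exp y"
    by (rule sums_unique[OF exp_converges, symmetric])
  finally show ?thesis
    by (simp add: divide_inverse mult.commute)
qed

text \<open>One term of the exponential series trades the power of \<open>x\<close> for a second
  factor \<open>exp (d * \<bar>x\<bar>)\<close>, and \<open>exp (2 * d * \<bar>x\<bar>)\<close> is
  at most the sum of the two one-sided exponentials. This is the majorant for all dominated
  convergence below.\<close>

lemma abs_power_exp_le:
  fixes x \<theta> d :: real
  assumes "d > 0"
  shows "\<bar>x\<bar> ^ k * exp (\<theta> * x + d * \<bar>x\<bar>)
     \<le> (fact k / d ^ k) * (exp ((\<theta> + 2 * d) * x) + exp ((\<theta> - 2 * d) * x))"
proof -
  have "(d * \<bar>x\<bar>) ^ k / fact k \<le> exp (d * \<bar>x\<bar>)"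
    using assms by (intro power_div_fact_le_exp) auto
  hence "\<bar>x\<bar> ^ k \<le> (fact k / d ^ k) * exp (d * \<bar>x\<bar>)"
    using assms by (simp add: field_simps power_mult_distrib)
  hence "\<bar>x\<bar> ^ k * exp (\<theta> * x + d * \<bar>x\<bar>)
     \<le> (fact k / d ^ k) * exp (d * \<bar>x\<bar>) * exp (\<theta> * x + d * \<bar>x\<bar>)"
    by (intro mult_right_mono) auto
  also have "\<dots> = (fact k / d ^ k) * exp (\<theta> * x + 2 * d * \<bar>x\<bar>)"
    by (simp add: mult_exp_exp)
  also have "\<dots> \<le> (fact k / d ^ k) * (exp ((\<theta> + 2 * d) * x) + exp ((\<theta> - 2 * d) * x))"
    using assms by (intro mult_left_mono; cases "x \<ge> 0") (auto simp: algebra_simps add_increasing add_increasing2)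
  finally show ?thesis .
qed

text \<open>The margin \<open>2 * d\<close> is the one consumed by the exponents in
  \<open>abs_power_exp_le\<close>.\<close>

lemma interior_cball_cgf_domain:
  assumes "\<theta> \<in> interior (cgf_domain P)"
  obtains d where "d > 0" "\<And>s. \<bar>s - \<theta>\<bar> \<le> 2 * d \<Longrightarrow> s \<in> cgf_domain P"
proof -
  obtain e where e: "e > 0" "cball \<theta> e \<subseteq> cgf_domain P"
    using assms mem_interior_cball by blast
  show ?thesis
    by (rule that[of "e / 2"]) (use e in \<open>auto simp: dist_real_def abs_minus_commute\<close>)
qed

lemma integrable_abs_power_exp:
  assumes P: "sets P = sets borel"
    and d: "d > 0" "\<And>s. \<bar>s - \<theta>\<bar> \<le> 2 * d \<Longrightarrow> s \<in> cgf_domain P"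
  shows "integrable P (\<lambda>x. \<bar>x\<bar> ^ k * exp (\<theta> * x + d * \<bar>x\<bar>))"
proof (rule Bochner_Integration.integrable_bound)
  have "integrable P (\<lambda>x. exp ((\<theta> + 2 * d) * x))" "integrable P (\<lambda>x. exp ((\<theta> - 2 * d) * x))"
    using d(2)[of "\<theta> + 2 * d"] d(2)[of "\<theta> - 2 * d"] d(1) by (auto simp: cgf_domain_def)
  thus "integrable P (\<lambda>x. (fact k / d ^ k) * (exp ((\<theta> + 2 * d) * x) + exp ((\<theta> - 2 * d) * x)))"
    by simp
  show "(\<lambda>x. \<bar>x\<bar> ^ k * exp (\<theta> * x + d * \<bar>x\<bar>)) \<in> borel_measurable P"
    by (subst measurable_cong_sets[OF P refl]) measurable
  show "AE x in P. norm (\<bar>x\<bar> ^ k * exp (\<theta> * x + d * \<bar>x\<bar>))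
      \<le> norm ((fact k / d ^ k) * (exp ((\<theta> + 2 * d) * x) + exp ((\<theta> - 2 * d) * x)))"
    using order_trans[OF abs_power_exp_le[OF d(1)] abs_ge_self]
    by (intro AE_I2) (simp add: abs_mult flip: power_abs)
qed

lemma integrable_exp_moment:
  assumes P: "sets P = sets borel" and z: "Re z \<in> interior (cgf_domain P)"
  shows "integrable P (\<lambda>x. complex_of_real (x ^ k) * exp (z * complex_of_real x))"
proof -
  obtain d where d: "d > 0" "\<And>s. \<bar>s - Re z\<bar> \<le> 2 * d \<Longrightarrow> s \<in> cgf_domain P"
    using interior_cball_cgf_domain[OF z] by blast
  show ?thesis
  proof (rule Bochner_Integration.integrable_bound[OF integrable_abs_power_exp[OF P d]])
    show "(\<lambda>x. complex_of_real (x ^ k) * exp (z * complex_of_real x)) \<in> borel_measurable P"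
      by (subst measurable_cong_sets[OF P refl]) measurable
    show "AE x in P. norm (complex_of_real (x ^ k) * exp (z * complex_of_real x))
        \<le> norm (\<bar>x\<bar> ^ k * exp (Re z * x + d * \<bar>x\<bar>))"
      using d(1) by (intro AE_I2) (auto simp: norm_mult norm_power abs_mult power_abs intro!: mult_left_mono)
  qed
qed

lemma integrable_real_exp_moment:
  assumes P: "sets P = sets borel" and z: "\<theta> \<in> interior (cgf_domain P)"
  shows "integrable P (\<lambda>x. x ^ k * exp (\<theta> * x))"
  using integrable_Re[OF integrable_exp_moment[of P "complex_of_real \<theta>" k]] P z
  by (simp flip: of_real_mult add: exp_of_real)

lemma exp_moment_of_real: "exp_moment P k (complex_of_real \<theta>) = of_real (real_exp_moment P k \<theta>)"
proof -
  have "complex_of_real (x ^ k) * exp (complex_of_real \<theta> * complex_of_real x)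
      = complex_of_real (x ^ k * exp (\<theta> * x))" for x
    by (simp add: exp_of_real[symmetric])
  thus ?thesis
    unfolding exp_moment_def real_exp_moment_def by (simp only: integral_complex_of_real)
qed

lemma norm_exp_minus_1_le: "norm (exp z - 1) \<le> exp \<bar>Re z\<bar> * norm (z::complex)"
  using Taylor_exp[of z 0] by simp

text \<open>Differentiation under the integral sign: for increments of norm below \<open>d\<close>
  the difference quotients are dominated by
  \<open>\<bar>x\<bar> ^ Suc k * exp (Re z * x + d * \<bar>x\<bar>)\<close>, which is integrable in
  the interior of the domain.\<close>

lemma has_field_derivative_exp_moment:
  assumes P: "sets P = sets borel" and z: "Re z \<in> interior (cgf_domain P)"
  shows "(exp_moment P k has_field_derivative exp_moment P (Suc k) z) (at z)"
proof -
  obtain d where d: "d > 0" "\<And>s. \<bar>s - Re z\<bar> \<le> 2 * d \<Longrightarrow> s \<in> cgf_domain P"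
    using interior_cball_cgf_domain[OF z] by blast
  let ?f = "\<lambda>z x. complex_of_real (x ^ k) * exp (z * complex_of_real x)"
  let ?S = "{h. norm h < d}"
  have S: "open ?S" "0 \<in> ?S" using d by (auto simp: open_Collect_less continuous_intros)
  have quot: "(exp_moment P k (z + h) - exp_moment P k z) / h
      = (\<integral>x. (?f (z + h) x - ?f z x) / h \<partial>P)" if h: "h \<in> ?S" for h
  proof -
    have "Re (z + h) \<in> interior (cgf_domain P)"
    proof (rule interiorI)
      show "open (ball (Re z) (2 * d))" by simp
      show "Re (z + h) \<in> ball (Re z) (2 * d)"
        using h d(1) abs_Re_le_cmod[of h] by (auto simp: dist_real_def)
      show "ball (Re z) (2 * d) \<subseteq> cgf_domain P"
        using d(2) by (auto simp: dist_real_def abs_minus_commute)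
    qed
    thus ?thesis unfolding exp_moment_def
      using integrable_exp_moment[OF P] z
      by (subst Bochner_Integration.integral_diff[symmetric]) auto
  qed
  \<comment> \<open>Restricting to the open ball \<open>?S\<close> keeps \<open>z + h\<close> inside
    the strip of integrability and does not change the limit at 0. The limit is tested along
    sequences because dominated convergence is a statement about sequences.\<close>
  have "((\<lambda>h. (\<integral>x. (?f (z + h) x - ?f z x) / h \<partial>P)) \<longlongrightarrow> exp_moment P (Suc k) z) (at 0 within ?S)"
  proof (unfold tendsto_at_iff_sequentially comp_def, intro allI impI)
    fix h :: "nat \<Rightarrow> complex" assume h: "\<forall>i. h i \<in> ?S - {0}" "h \<longlonglongrightarrow> 0"
    show "(\<lambda>i. (\<integral>x. (?f (z + h i) x - ?f z x) / h i \<partial>P)) \<longlonglongrightarrow> exp_moment P (Suc k) z"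
      unfolding exp_moment_def
    proof (rule integral_dominated_convergence[OF _ _ integrable_abs_power_exp[OF P d]])
      show "(\<lambda>x. complex_of_real (x ^ Suc k) * exp (z * complex_of_real x)) \<in> borel_measurable P"
        by (subst measurable_cong_sets[OF P refl]) measurable
      show "(\<lambda>x. (?f (z + h i) x - ?f z x) / h i) \<in> borel_measurable P" for i
        by (subst measurable_cong_sets[OF P refl]) measurable
      show "AE x in P. (\<lambda>i. (?f (z + h i) x - ?f z x) / h i)
          \<longlonglongrightarrow> complex_of_real (x ^ Suc k) * exp (z * complex_of_real x)"
      proof (rule AE_I2)
        fix x
        have "((\<lambda>z. ?f z x) has_field_derivative complex_of_real (x ^ Suc k) * exp (z * complex_of_real x)) (at z)"
          by (auto intro!: derivative_eq_intros)
        hence "((\<lambda>h. (?f (z + h) x - ?f z x) / h) \<longlongrightarrow> complex_of_real (x ^ Suc k) * exp (z * complex_of_real x)) (at 0)"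
          by (simp add: DERIV_def)
        thus "(\<lambda>i. (?f (z + h i) x - ?f z x) / h i)
          \<longlonglongrightarrow> complex_of_real (x ^ Suc k) * exp (z * complex_of_real x)"
          using h by (auto simp: tendsto_at_iff_sequentially comp_def)
      qed
      show "AE x in P. norm ((?f (z + h i) x - ?f z x) / h i)
          \<le> \<bar>x\<bar> ^ Suc k * exp (Re z * x + d * \<bar>x\<bar>)" for i
      proof (rule AE_I2)
        fix x
        have hi: "norm (h i) < d" "h i \<noteq> 0" using h by auto
        have "?f (z + h i) x - ?f z x = ?f z x * (exp (h i * x) - 1)"
          by (simp add: algebra_simps exp_add)
        hence "norm ((?f (z + h i) x - ?f z x) / h i)
            = \<bar>x\<bar> ^ k * exp (Re z * x) * norm (exp (h i * x) - 1) / norm (h i)"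
          by (simp add: norm_mult norm_divide norm_power)
        also have "\<dots> \<le> \<bar>x\<bar> ^ k * exp (Re z * x) * (exp \<bar>Re (h i * x)\<bar> * norm (h i * x)) / norm (h i)"
          by (intro divide_right_mono mult_left_mono norm_exp_minus_1_le) auto
        also have "\<dots> = \<bar>x\<bar> ^ Suc k * exp (Re z * x) * exp \<bar>Re (h i * x)\<bar>"
          using hi by (simp add: norm_mult)
        also have "\<bar>Re (h i * x)\<bar> \<le> d * \<bar>x\<bar>"
          using hi abs_Re_le_cmod[of "h i"] by (auto simp: abs_mult intro!: mult_right_mono)
        hence "\<bar>x\<bar> ^ Suc k * exp (Re z * x) * exp \<bar>Re (h i * x)\<bar>
            \<le> \<bar>x\<bar> ^ Suc k * exp (Re z * x) * exp (d * \<bar>x\<bar>)"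
          by (intro mult_left_mono) auto
        finally show "norm ((?f (z + h i) x - ?f z x) / h i)
          \<le> \<bar>x\<bar> ^ Suc k * exp (Re z * x + d * \<bar>x\<bar>)"
          by (simp add: exp_add mult_ac)
      qed
    qed
  qed
  hence "((\<lambda>h. (exp_moment P k (z + h) - exp_moment P k z) / h) \<longlongrightarrow> exp_moment P (Suc k) z) (at 0 within ?S)"
    by (rule Lim_transform_within[OF _ zero_less_one]) (simp only: quot)
  thus ?thesis
    unfolding DERIV_def at_within_open[OF S(2) S(1)] .
qed

lemma has_field_derivative_real_exp_moment:
  assumes P: "sets P = sets borel" and \<theta>: "\<theta> \<in> interior (cgf_domain P)"
  shows "(real_exp_moment P k has_field_derivative real_exp_moment P (Suc k) \<theta>) (at \<theta>)"
proof -
  have "((\<lambda>t. exp_moment P k (complex_of_real t)) has_vector_derivative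
      exp_moment P (Suc k) (complex_of_real \<theta>)) (at \<theta>)"
    using has_field_derivative_exp_moment[OF P, of "complex_of_real \<theta>" k] \<theta>
    by (intro has_vector_derivative_real_field) auto
  from has_field_derivative_Re[OF this] show ?thesis
    by (simp add: exp_moment_of_real)
qed

text \<open>The exponential at a convex combination is at most the larger of the two end
  exponentials, hence at most their sum.\<close>

lemma convex_cgf_domain:
  assumes P: "sets P = sets borel"
  shows "convex (cgf_domain P)"
proof (rule convexI)
  fix x y u v :: real
  assume *: "x \<in> cgf_domain P" "y \<in> cgf_domain P" "0 \<le> u" "0 \<le> v" "u + v = 1"
  show "u *\<^sub>R x + v *\<^sub>R y \<in> cgf_domain P" unfolding cgf_domain_def mem_Collect_eq
  proof (rule Bochner_Integration.integrable_bound)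
    show "integrable P (\<lambda>t. exp (x * t) + exp (y * t))"
      using * by (auto simp: cgf_domain_def)
    show "(\<lambda>t. exp ((u *\<^sub>R x + v *\<^sub>R y) * t)) \<in> borel_measurable P"
      by (subst measurable_cong_sets[OF P refl]) measurable
    show "AE t in P. norm (exp ((u *\<^sub>R x + v *\<^sub>R y) * t)) \<le> norm (exp (x * t) + exp (y * t))"
    proof (rule AE_I2)
      fix t
      have "(u * x + v * y) * t = u * (x * t) + v * (y * t)" by (simp add: algebra_simps)
      also have "\<dots> \<le> max (x * t) (y * t)"
        using convex_bound_le[of "x * t" "max (x*t) (y*t)" "y * t" u v] * by auto
      finally have "exp ((u * x + v * y) * t) \<le> exp (max (x * t) (y * t))" by simp
      also have "\<dots> \<le> exp (x * t) + exp (y * t)" by (auto simp: max_def)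
      finally show "norm (exp ((u *\<^sub>R x + v *\<^sub>R y) * t)) \<le> norm (exp (x * t) + exp (y * t))"
        by (simp add: add_nonneg_nonneg)
    qed
  qed
qed

lemma real_exp_moment_0_pos:
  assumes "prob_space P" "sets P = sets borel" "\<theta> \<in> cgf_domain P"
  shows "real_exp_moment P 0 \<theta> > 0"
proof -
  interpret prob_space P by fact
  have "real_exp_moment P 0 \<theta> \<ge> 0" unfolding real_exp_moment_def by simp
  moreover have "real_exp_moment P 0 \<theta> \<noteq> 0"
  proof
    assume "real_exp_moment P 0 \<theta> = 0"
    hence "AE x in P. exp (\<theta> * x) = 0"
      unfolding real_exp_moment_def
      using assms by (subst (asm) integral_nonneg_eq_0_iff_AE) (auto simp: cgf_domain_def)
    hence "AE x in P. False" by simp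
    thus False by (simp add: AE_False)
  qed
  ultimately show ?thesis by simp
qed

lemma exp_cgf:
  assumes "prob_space P" "sets P = sets borel" "\<theta> \<in> cgf_domain P"
  shows "exp (cgf P \<theta>) = real_exp_moment P 0 \<theta>"
  using real_exp_moment_0_pos[OF assms] by (simp add: cgf_def real_exp_moment_def)

section \<open>Tilted measures and uniqueness of moment generating functions\<close>

definition exp_tilt :: "real measure \<Rightarrow> real \<Rightarrow> real measure" where
  "exp_tilt P \<theta> = density P (\<lambda>x. ennreal (exp (\<theta> * x - cgf P \<theta>)))"

text \<open>Written through moments of the fixed measure \<open>P\<close>, rather than as an
  expectation under the tilted measure, so that it can be differentiated in \<theta>.\<close>

definition tilt_mean :: "real measure \<Rightarrow> real \<Rightarrow> real" where
  "tilt_mean P \<theta> = real_exp_moment P 1 \<theta> / real_exp_moment P 0 \<theta>"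

definition tilt_variance :: "real measure \<Rightarrow> real \<Rightarrow> real" where
  "tilt_variance P \<theta> = real_exp_moment P 2 \<theta> / real_exp_moment P 0 \<theta> - (tilt_mean P \<theta>)\<^sup>2"

lemma sets_exp_tilt [simp]: "sets (exp_tilt P \<theta>) = sets P"
  by (simp add: exp_tilt_def)

lemma measurable_exp_affine:
  fixes P :: "real measure" and \<theta> c :: real
  assumes "sets P = sets borel"
  shows "(\<lambda>x. exp (\<theta> * x - c)) \<in> borel_measurable P"
  by (subst measurable_cong_sets[OF assms refl]) measurable

lemma exp_tilt_integrable_iff:
  fixes f :: "real \<Rightarrow> 'b::{banach, second_countable_topology}"
  assumes P: "sets P = sets borel" and f: "f \<in> borel_measurable borel"
  shows "integrable (exp_tilt P \<theta>) f \<longleftrightarrow> integrable P (\<lambda>x. exp (\<theta> * x - cgf P \<theta>) *\<^sub>R f x)"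
  unfolding exp_tilt_def
  by (rule integrable_density) (use f in \<open>auto simp: measurable_cong_sets[OF P refl]\<close>)

lemma exp_tilt_integral:
  fixes f :: "real \<Rightarrow> 'b::{banach, second_countable_topology}"
  assumes P: "sets P = sets borel" and f: "f \<in> borel_measurable borel"
  shows "integral\<^sup>L (exp_tilt P \<theta>) f = (\<integral>x. exp (\<theta> * x - cgf P \<theta>) *\<^sub>R f x \<partial>P)"
  unfolding exp_tilt_def
  by (rule integral_density) (use f in \<open>auto simp: measurable_cong_sets[OF P refl]\<close>)

lemma prob_space_exp_tilt:
  assumes "prob_space P" "sets P = sets borel" "\<theta> \<in> cgf_domain P"
  shows "prob_space (exp_tilt P \<theta>)"
proof
  have "emeasure (exp_tilt P \<theta>) (space (exp_tilt P \<theta>)) = (\<integral>\<^sup>+x. ennreal (exp (\<theta> * x - cgf P \<theta>)) \<partial>P)"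
    unfolding exp_tilt_def
    by (subst emeasure_density)
      (use measurable_exp_affine[OF assms(2)] in \<open>auto intro!: nn_integral_cong simp: assms(2) sets_eq_imp_space_eq[OF assms(2)]\<close>)
  also have "\<dots> = ennreal (\<integral>x. exp (\<theta> * x - cgf P \<theta>) \<partial>P)"
    using assms(3) by (intro nn_integral_eq_integral) (auto simp: exp_diff cgf_domain_def)
  also have "(\<integral>x. exp (\<theta> * x - cgf P \<theta>) \<partial>P) = real_exp_moment P 0 \<theta> / exp (cgf P \<theta>)"
    by (simp add: exp_diff real_exp_moment_def)
  also have "\<dots> = 1"
    by (subst exp_cgf[OF assms, symmetric]) simp
  finally show "emeasure (exp_tilt P \<theta>) (space (exp_tilt P \<theta>)) = 1" by simp
qed

lemma cgf_domain_exp_tilt: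
  assumes P: "sets P = sets borel"
  shows "s \<in> cgf_domain (exp_tilt P \<theta>) \<longleftrightarrow> \<theta> + s \<in> cgf_domain P"
proof -
  have "exp (\<theta> * x - cgf P \<theta>) *\<^sub>R exp (s * x) = exp (- cgf P \<theta>) * exp ((\<theta> + s) * x)" for x
    by (simp add: mult_exp_exp algebra_simps)
  thus ?thesis
    unfolding cgf_domain_def mem_Collect_eq by (subst exp_tilt_integrable_iff[OF P]) auto
qed

lemma real_exp_moment_exp_tilt:
  assumes P: "sets P = sets borel"
  shows "real_exp_moment (exp_tilt P \<theta>) k s = exp (- cgf P \<theta>) * real_exp_moment P k (\<theta> + s)"
proof -
  have "exp (\<theta> * x - cgf P \<theta>) *\<^sub>R (x ^ k * exp (s * x)) = exp (- cgf P \<theta>) * (x ^ k * exp ((\<theta> + s) * x))" for x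
    by (simp add: mult_exp_exp algebra_simps)
  thus ?thesis
    unfolding real_exp_moment_def
    by (subst exp_tilt_integral[OF P]) (measurable, simp only: integral_mult_right_zero)
qed

lemma char_exp_tilt:
  assumes P: "sets P = sets borel"
  shows "char (exp_tilt P \<theta>) t = of_real (exp (- cgf P \<theta>)) * exp_moment P 0 (Complex \<theta> t)"
proof -
  have "exp (\<theta> * x - cgf P \<theta>) *\<^sub>R iexp (t * x)
      = of_real (exp (- cgf P \<theta>)) * (complex_of_real (x ^ 0) * exp (Complex \<theta> t * complex_of_real x))" for x
    by (simp add: scaleR_conv_of_real exp_of_real[symmetric] mult_exp_exp Complex_eq algebra_simps)
  thus ?thesis
    unfolding char_def exp_moment_def by (subst exp_tilt_integral[OF P]) auto
qed

text \<open>The tilting density never vanishes and is undone by its reciprocal, so an equality of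
  tilted measures descends to the untilted ones.\<close>

lemma density_exp_tilt_inverse:
  assumes P: "sets P = sets borel"
  shows "density (exp_tilt P \<theta>) (\<lambda>x. ennreal (exp (cgf P \<theta> - \<theta> * x))) = P"
proof -
  have "density (exp_tilt P \<theta>) (\<lambda>x. ennreal (exp (cgf P \<theta> - \<theta> * x))) = density P (\<lambda>x. 1)"
    unfolding exp_tilt_def
    by (subst density_density_eq)
      (auto simp: ennreal_mult[symmetric] mult_exp_exp measurable_cong_sets[OF P refl] intro!: density_cong)
  thus ?thesis by (simp add: density_1)
qed

text \<open>The two moment generating functions extend to a common vertical strip, so by the identity
  theorem they are proportional there; on a vertical line they are, up to a factor, the
  characteristic functions of the tilted measures.\<close>

theorem exp_moment_unique:
  assumes P: "prob_space P" "sets P = sets borel"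
    and Q: "prob_space Q" "sets Q = sets borel"
    and U: "open U" "U \<noteq> {}" "U \<subseteq> cgf_domain P" "U \<subseteq> cgf_domain Q"
    and eq: "\<And>s. s \<in> U \<Longrightarrow> real_exp_moment P 0 s = C * real_exp_moment Q 0 s"
  shows "P = Q"
proof -
  obtain \<theta> where \<theta>: "\<theta> \<in> U" using U by blast
  then obtain e where e: "e > 0" "ball \<theta> e \<subseteq> U" using U(1) open_contains_ball by blast
  define S where "S = {z. Re z \<in> ball \<theta> e}"
  have S_alt: "S = Re -` ball \<theta> e" by (auto simp: S_def)
  have "open S" unfolding S_alt by (intro open_vimage continuous_intros) auto
  have "convex S" unfolding S_alt by (intro convex_linear_vimage) (auto simp: bounded_linear.linear bounded_linear_Re)
  have SP: "Re z \<in> interior (cgf_domain P)" "Re z \<in> interior (cgf_domain Q)" if "z \<in> S" for z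
    using that e U by (auto simp: S_def intro!: interiorI[OF U(1)])
  have hol: "exp_moment P 0 holomorphic_on S" "exp_moment Q 0 holomorphic_on S"
    unfolding holomorphic_on_def field_differentiable_def
    using SP has_field_derivative_at_within[OF has_field_derivative_exp_moment[OF P(2)]]
      has_field_derivative_at_within[OF has_field_derivative_exp_moment[OF Q(2)]]
    by blast+
  have cont: "exp_moment P 0 z - of_real C * exp_moment Q 0 z = 0" if "z \<in> S" for z
  proof (rule analytic_continuation[where
      f = "\<lambda>z. exp_moment P 0 z - of_real C * exp_moment Q 0 z" and \<xi> = "of_real \<theta>" and U = "of_real ` ball \<theta> e" and S = S])
    show "(\<lambda>z. exp_moment P 0 z - of_real C * exp_moment Q 0 z) holomorphic_on S"
      by (intro holomorphic_intros hol)
    show "connected S" using \<open>convex S\<close> by (rule convex_connected)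
    show "complex_of_real \<theta> islimpt complex_of_real ` ball \<theta> e"
      unfolding islimpt_approachable
    proof (intro allI impI)
      fix d :: real assume "d > 0"
      thus "\<exists>x'\<in>complex_of_real ` ball \<theta> e. x' \<noteq> complex_of_real \<theta> \<and> dist x' (complex_of_real \<theta>) < d"
        using e(1) by (intro bexI[of _ "of_real (\<theta> + min d e / 2)"] imageI conjI)
          (auto simp: dist_norm min_def simp flip: of_real_diff of_real_add)
    qed
    show "exp_moment P 0 w - of_real C * exp_moment Q 0 w = 0" if "w \<in> complex_of_real ` ball \<theta> e" for w
      using that e(2) eq by (auto simp: exp_moment_of_real)
  qed (use \<open>open S\<close> that e in \<open>auto simp: S_def\<close>)
  have mP: "\<theta> \<in> cgf_domain P" and mQ: "\<theta> \<in> cgf_domain Q" using \<theta> U by auto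
  \<comment> \<open>Evaluation at \<theta> identifies \<open>C\<close> as the ratio of the norming
    constants of the two tilts, so it cancels after normalisation.\<close>
  have "exp (cgf P \<theta>) = C * exp (cgf Q \<theta>)"
    using eq[OF \<theta>] exp_cgf[OF P mP] exp_cgf[OF Q mQ] by simp
  hence "C = exp (cgf P \<theta> - cgf Q \<theta>)"
    by (simp add: exp_diff)
  hence C: "exp (- cgf P \<theta>) * C = exp (- cgf Q \<theta>)"
    by (simp add: mult_exp_exp)
  have char: "char (exp_tilt P \<theta>) = char (exp_tilt Q \<theta>)"
  proof
    fix t
    have "exp_moment P 0 (Complex \<theta> t) = of_real C * exp_moment Q 0 (Complex \<theta> t)"
      using cont[of "Complex \<theta> t"] e(1) by (simp add: S_def)
    thus "char (exp_tilt P \<theta>) t = char (exp_tilt Q \<theta>) t"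
      by (simp add: char_exp_tilt P Q C[symmetric])
  qed
  interpret P': prob_space "exp_tilt P \<theta>" by (rule prob_space_exp_tilt[OF P mP])
  interpret Q': prob_space "exp_tilt Q \<theta>" by (rule prob_space_exp_tilt[OF Q mQ])
  have tilt: "exp_tilt P \<theta> = exp_tilt Q \<theta>"
    by (rule Levy_uniqueness[OF _ _ char]; unfold_locales)
      (use P Q in \<open>auto simp: sets_eq_imp_space_eq\<close>)
  have m0: "real_exp_moment N 0 0 = 1" if "prob_space N" for N
    using prob_space.prob_space[OF that] by (simp add: real_exp_moment_def)
  \<comment> \<open>Tilting back by \<open>- \<theta>\<close> gives the total masses of
    \<open>P\<close> and \<open>Q\<close>, both 1. Hence the norming constants agree and both tilts
    are undone by the same density.\<close>
  have "exp (- cgf P \<theta>) = exp (- cgf Q \<theta>)"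
    using arg_cong[OF tilt, of "\<lambda>N. real_exp_moment N 0 (- \<theta>)"] P Q
    by (simp add: real_exp_moment_exp_tilt m0)
  hence "cgf P \<theta> = cgf Q \<theta>" by simp
  hence "density (exp_tilt P \<theta>) (\<lambda>x. ennreal (exp (cgf P \<theta> - \<theta> * x)))
      = density (exp_tilt Q \<theta>) (\<lambda>x. ennreal (exp (cgf Q \<theta> - \<theta> * x)))"
    using tilt by simp
  thus ?thesis
    unfolding density_exp_tilt_inverse[OF P(2)] density_exp_tilt_inverse[OF Q(2)] .
qed

section \<open>Mean and variance of the tilted measures as derivatives of the cumulant
  function\<close>

lemma has_field_derivative_cgf:
  assumes P: "prob_space P" "sets P = sets borel" and \<theta>: "\<theta> \<in> interior (cgf_domain P)"
  shows "(cgf P has_field_derivative tilt_mean P \<theta>) (at \<theta>)"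
proof -
  have "cgf P = (\<lambda>\<theta>. ln (real_exp_moment P 0 \<theta>))"
    by (auto simp: cgf_def real_exp_moment_def)
  moreover have "real_exp_moment P 0 \<theta> > 0"
    using \<theta> interior_subset by (intro real_exp_moment_0_pos[OF P]) auto
  ultimately show ?thesis
    by (auto intro!: derivative_eq_intros has_field_derivative_real_exp_moment[OF P(2) \<theta>] simp: tilt_mean_def)
qed

lemma deriv_cgf:
  assumes P: "prob_space P" "sets P = sets borel" and \<theta>: "\<theta> \<in> interior (cgf_domain P)"
  shows "deriv (cgf P) \<theta> = tilt_mean P \<theta>"
  by (rule DERIV_imp_deriv has_field_derivative_cgf assms)+

lemma has_field_derivative_tilt_mean:
  assumes P: "prob_space P" "sets P = sets borel" and \<theta>: "\<theta> \<in> interior (cgf_domain P)"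
  shows "(tilt_mean P has_field_derivative tilt_variance P \<theta>) (at \<theta>)"
proof -
  have "tilt_mean P = (\<lambda>\<theta>. real_exp_moment P 1 \<theta> / real_exp_moment P 0 \<theta>)"
    by (auto simp: tilt_mean_def)
  moreover have "real_exp_moment P 0 \<theta> > 0"
    using \<theta> interior_subset by (intro real_exp_moment_0_pos[OF P]) auto
  ultimately show ?thesis
    by (auto intro!: derivative_eq_intros has_field_derivative_real_exp_moment[OF P(2) \<theta>]
        simp: tilt_mean_def tilt_variance_def field_simps power2_eq_square numeral_2_eq_2)
qed

text \<open>Lets the variance at a single parameter be read off from its values nearby.\<close>

lemma continuous_tilt_variance:
  assumes P: "prob_space P" "sets P = sets borel" and \<theta>: "\<theta> \<in> interior (cgf_domain P)"
  shows "isCont (tilt_variance P) \<theta>"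
proof -
  have "isCont (real_exp_moment P k) \<theta>" for k
    by (rule DERIV_isCont[OF has_field_derivative_real_exp_moment[OF P(2) \<theta>]])
  moreover have "real_exp_moment P 0 \<theta> > 0"
    using \<theta> interior_subset by (intro real_exp_moment_0_pos[OF P]) auto
  moreover have "isCont (tilt_mean P) \<theta>"
    by (rule DERIV_isCont[OF has_field_derivative_tilt_mean[OF P \<theta>]])
  ultimately show ?thesis
    unfolding tilt_variance_def [abs_def] by (intro continuous_intros) auto
qed

lemma variance_exp_tilt:
  assumes P: "prob_space P" "sets P = sets borel" and \<theta>: "\<theta> \<in> interior (cgf_domain P)"
  shows "prob_space.variance (exp_tilt P \<theta>) (\<lambda>x. x) = tilt_variance P \<theta>"
    and "integrable (exp_tilt P \<theta>) (\<lambda>x. (x - c)\<^sup>2)"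
proof -
  have dom: "\<theta> \<in> cgf_domain P" using \<theta> interior_subset by auto
  interpret prob_space "exp_tilt P \<theta>" by (rule prob_space_exp_tilt[OF P dom])
  \<comment> \<open>Tilting by \<theta> translates the domain by \<open>- \<theta>\<close>, so 0
    becomes an interior point and all moments of the tilted measure exist.\<close>
  have "open ((\<lambda>s. \<theta> + s) -` interior (cgf_domain P))"
    by (intro open_vimage continuous_intros) auto
  moreover have "(\<lambda>s. \<theta> + s) -` interior (cgf_domain P) \<subseteq> cgf_domain (exp_tilt P \<theta>)"
    using interior_subset[of "cgf_domain P"] by (auto simp: cgf_domain_exp_tilt P)
  ultimately have "0 \<in> interior (cgf_domain (exp_tilt P \<theta>))"
    using \<theta> by (auto intro: interiorI)
  from integrable_real_exp_moment[OF _ this]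
  have int: "integrable (exp_tilt P \<theta>) (\<lambda>x. x ^ k)" for k using P by simp
  have mom: "(\<integral>x. x ^ k \<partial>exp_tilt P \<theta>) = real_exp_moment P k \<theta> / real_exp_moment P 0 \<theta>" for k
    using real_exp_moment_exp_tilt[OF P(2), of \<theta> k 0] exp_cgf[OF P dom]
    by (simp add: real_exp_moment_def exp_minus field_simps)
  have "variance (\<lambda>x. x) = expectation (\<lambda>x. x\<^sup>2) - (expectation (\<lambda>x. x))\<^sup>2"
    using int[of 1] int[of 2] by (intro variance_eq) auto
  thus "prob_space.variance (exp_tilt P \<theta>) (\<lambda>x. x) = tilt_variance P \<theta>"
    using mom[of 1] mom[of 2] by (simp add: tilt_variance_def tilt_mean_def)
  show "integrable (exp_tilt P \<theta>) (\<lambda>x. (x - c)\<^sup>2)"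
    using int[of 1] int[of 2] by (simp add: power2_diff)
qed

text \<open>A vanishing variance would concentrate the tilted measure at its mean, and with it
  \<open>P\<close>, since the tilting density is strictly positive.\<close>

lemma tilt_variance_pos:
  assumes P: "prob_space P" "sets P = sets borel" "\<not> (\<exists>a. AE x in P. x = a)"
    and \<theta>: "\<theta> \<in> interior (cgf_domain P)"
  shows "tilt_variance P \<theta> > 0"
proof -
  have dom: "\<theta> \<in> cgf_domain P" using \<theta> interior_subset by auto
  interpret prob_space "exp_tilt P \<theta>" by (rule prob_space_exp_tilt[OF P(1,2) dom])
  have "variance (\<lambda>x. x) \<ge> 0" by simp
  moreover have "variance (\<lambda>x. x) \<noteq> 0"
  proof
    assume "variance (\<lambda>x. x) = 0"
    hence "AE x in exp_tilt P \<theta>. (x - expectation (\<lambda>x. x))\<^sup>2 = 0"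
      by (subst (asm) integral_nonneg_eq_0_iff_AE) (auto intro: variance_exp_tilt[OF P(1,2) \<theta>])
    hence "AE x in P. x = expectation (\<lambda>x. x)"
      unfolding exp_tilt_def
      by (subst (asm) AE_density) (auto simp: measurable_cong_sets[OF P(2) refl])
    thus False using P(3) by blast
  qed
  ultimately show ?thesis using variance_exp_tilt(1)[OF P(1,2) \<theta>] by linarith
qed

section \<open>Levy processes\<close>

context
  fixes M :: "'a measure" and Y :: "real \<Rightarrow> 'a \<Rightarrow> real"
  assumes M: "prob_space M" and Y: "levy_process M Y"
begin

interpretation prob_space M by (rule M)

lemma levy_measurable: "t \<ge> 0 \<Longrightarrow> Y t \<in> borel_measurable M"
  using Y by (simp add: levy_process_def)

lemma levy_zero: "AE \<omega> in M. Y 0 \<omega> = 0"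
  using Y by (simp add: levy_process_def)

lemma levy_indep_increments:
  assumes "0 \<le> t 0" "\<And>i. i < n \<Longrightarrow> t i \<le> t (Suc i)"
  shows "indep_vars (\<lambda>_. borel) (\<lambda>i \<omega>. Y (t (Suc i)) \<omega> - Y (t i) \<omega>) {..<n}"
proof -
  have "\<forall>(n::nat) t. 0 \<le> t 0 \<longrightarrow> (\<forall>i<n. t i \<le> t (Suc i)) \<longrightarrow>
      indep_vars (\<lambda>_. borel) (\<lambda>i \<omega>. Y (t (Suc i)) \<omega> - Y (t i) \<omega>) {..<n}"
    using Y unfolding levy_process_def by (elim conjE)
  thus ?thesis using assms by blast
qed

lemma levy_stationary_increments:
  assumes "0 \<le> s" "s \<le> t"
  shows "distr M borel (\<lambda>\<omega>. Y t \<omega> - Y s \<omega>) = distr M borel (Y (t - s))"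
proof -
  have "\<forall>s\<ge>0. \<forall>t\<ge>0. distr M borel (\<lambda>\<omega>. Y (s + t) \<omega> - Y s \<omega>) = distr M borel (Y t)"
    using Y unfolding levy_process_def by (elim conjE)
  from this[rule_format, of s "t - s"] show ?thesis using assms by simp
qed

lemma levy_continuous_in_probability:
  assumes "t \<ge> 0" "e > 0"
  shows "((\<lambda>s. measure M {\<omega> \<in> space M. \<bar>Y s \<omega> - Y t \<omega>\<bar> > e}) \<longlongrightarrow> 0) (at t within {0..})"
  using Y assms unfolding levy_process_def by (elim conjE) blast

text \<open>\<open>Y (s + t)\<close> is almost surely the sum of two independent increments, the
  second distributed as \<open>Y t\<close>. The nonnegative integral allows both sides to be
  infinite, so no integrability has to be known in advance.\<close>

lemma levy_nn_mgf_add: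
  assumes st: "s \<ge> 0" "t \<ge> 0"
  shows "(\<integral>\<^sup>+\<omega>. ennreal (exp (\<theta> * Y (s + t) \<omega>)) \<partial>M)
    = (\<integral>\<^sup>+\<omega>. ennreal (exp (\<theta> * Y s \<omega>)) \<partial>M) * (\<integral>\<^sup>+\<omega>. ennreal (exp (\<theta> * Y t \<omega>)) \<partial>M)"
proof -
  \<comment> \<open>The partition times 0, s, s + t. The first increment is
    \<open>Y s - Y 0\<close>, which equals \<open>Y s\<close> only almost surely.\<close>
  define u where "u i = (if i = 0 then 0 else if i = Suc 0 then s else s + t)" for i :: nat
  let ?D = "\<lambda>i \<omega>. Y (u (Suc i)) \<omega> - Y (u i) \<omega>"
  have meas [measurable]: "Y 0 \<in> borel_measurable M" "Y s \<in> borel_measurable M"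
      "Y t \<in> borel_measurable M" "Y (s + t) \<in> borel_measurable M"
    using st by (auto intro: levy_measurable)
  have "indep_vars (\<lambda>_. borel) ?D {..<2}"
    using st by (intro levy_indep_increments) (auto simp: u_def)
  hence "indep_vars (\<lambda>_. borel) (\<lambda>i \<omega>. ennreal (exp (\<theta> * ?D i \<omega>))) {..<2}"
    by (rule indep_vars_compose2) auto
  hence "(\<integral>\<^sup>+\<omega>. (\<Prod>i\<in>{..<2}. ennreal (exp (\<theta> * ?D i \<omega>))) \<partial>M)
      = (\<Prod>i\<in>{..<2}. \<integral>\<^sup>+\<omega>. ennreal (exp (\<theta> * ?D i \<omega>)) \<partial>M)"
    by (intro indep_vars_nn_integral) auto
  hence prod: "(\<integral>\<^sup>+\<omega>. ennreal (exp (\<theta> * (Y s \<omega> - Y 0 \<omega>))) * ennreal (exp (\<theta> * (Y (s + t) \<omega> - Y s \<omega>))) \<partial>M)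
      = (\<integral>\<^sup>+\<omega>. ennreal (exp (\<theta> * (Y s \<omega> - Y 0 \<omega>))) \<partial>M)
        * (\<integral>\<^sup>+\<omega>. ennreal (exp (\<theta> * (Y (s + t) \<omega> - Y s \<omega>))) \<partial>M)"
    by (simp add: u_def numeral_2_eq_2)
  have "(\<integral>\<^sup>+\<omega>. ennreal (exp (\<theta> * Y (s + t) \<omega>)) \<partial>M)
      = (\<integral>\<^sup>+\<omega>. ennreal (exp (\<theta> * (Y s \<omega> - Y 0 \<omega>))) * ennreal (exp (\<theta> * (Y (s + t) \<omega> - Y s \<omega>))) \<partial>M)"
    using levy_zero
    by (intro nn_integral_cong_AE) (auto simp: ennreal_mult[symmetric] mult_exp_exp algebra_simps)
  also note prod
  also have "(\<integral>\<^sup>+\<omega>. ennreal (exp (\<theta> * (Y s \<omega> - Y 0 \<omega>))) \<partial>M) = (\<integral>\<^sup>+\<omega>. ennreal (exp (\<theta> * Y s \<omega>)) \<partial>M)"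
    using levy_zero by (intro nn_integral_cong_AE) auto
  also have "(\<integral>\<^sup>+\<omega>. ennreal (exp (\<theta> * (Y (s + t) \<omega> - Y s \<omega>))) \<partial>M)
      = (\<integral>\<^sup>+x. ennreal (exp (\<theta> * x)) \<partial>distr M borel (\<lambda>\<omega>. Y (s + t) \<omega> - Y s \<omega>))"
    by (subst nn_integral_distr) auto
  also have "distr M borel (\<lambda>\<omega>. Y (s + t) \<omega> - Y s \<omega>) = distr M borel (Y t)"
    using levy_stationary_increments[of s "s + t"] st by simp
  also have "(\<integral>\<^sup>+x. ennreal (exp (\<theta> * x)) \<partial>distr M borel (Y t)) = (\<integral>\<^sup>+\<omega>. ennreal (exp (\<theta> * Y t \<omega>)) \<partial>M)"
    by (subst nn_integral_distr) auto
  finally show ?thesis .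
qed

text \<open>Continuity in probability makes the distances truncated at 1 tend to 0 in mean, and mean
  convergence yields an almost surely convergent subsequence. The times \<open>r n\<close> must
  avoid \<open>t\<close> because the continuity is stated for a punctured neighbourhood.\<close>

lemma levy_AE_subseq:
  assumes t: "t \<ge> 0" and r: "\<And>n. r n \<ge> 0" "\<And>n. r n \<noteq> t" "r \<longlonglongrightarrow> t"
  obtains k :: "nat \<Rightarrow> nat" where "strict_mono k" "AE \<omega> in M. (\<lambda>n. Y (r (k n)) \<omega>) \<longlonglongrightarrow> Y t \<omega>"
proof -
  have meas [measurable]: "Y (r n) \<in> borel_measurable M" "Y t \<in> borel_measurable M" for n
    using t r by (auto intro: levy_measurable)
  let ?u = "\<lambda>n \<omega>. min 1 \<bar>Y (r n) \<omega> - Y t \<omega>\<bar>"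
  have int: "integrable M (?u n)" for n
    by (rule integrable_const_bound[of _ 1]) auto
  have "(\<lambda>n. \<integral>\<omega>. norm (?u n \<omega>) \<partial>M) \<longlonglongrightarrow> 0"
  proof (rule LIMSEQ_I)
    fix e :: real assume e: "e > 0"
    let ?A = "\<lambda>n. {\<omega> \<in> space M. \<bar>Y (r n) \<omega> - Y t \<omega>\<bar> > e / 2}"
    have "(\<lambda>n. measure M (?A n)) \<longlonglongrightarrow> 0"
      using levy_continuous_in_probability[OF t, of "e / 2"] e r
      by (auto simp: tendsto_at_iff_sequentially comp_def)
    then obtain N where N: "\<And>n. n \<ge> N \<Longrightarrow> measure M (?A n) < e / 2"
      using LIMSEQ_D[of _ 0 "e / 2"] e by fastforce
    have "norm ((\<integral>\<omega>. norm (?u n \<omega>) \<partial>M) - 0) < e" if "n \<ge> N" for n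
    proof -
      have int_A: "integrable M (indicat_real (?A n))"
        by (intro integrable_real_indicator) (auto simp: less_top[symmetric])
      have "(\<integral>\<omega>. norm (?u n \<omega>) \<partial>M) \<le> (\<integral>\<omega>. e / 2 + indicator (?A n) \<omega> \<partial>M)"
      proof (intro integral_mono integrable_norm int)
        show "integrable M (\<lambda>\<omega>. e / 2 + indicat_real (?A n) \<omega>)"
          by (intro Bochner_Integration.integrable_add integrable_const int_A)
        show "norm (?u n \<omega>) \<le> e / 2 + indicat_real (?A n) \<omega>" if "\<omega> \<in> space M" for \<omega>
          using that e by (cases "\<omega> \<in> ?A n") (auto simp: min_def)
      qed
      also have "\<dots> = e / 2 + measure M (?A n)"
        by (subst Bochner_Integration.integral_add[OF integrable_const int_A]) (auto simp: prob_space)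
      also have "\<dots> < e" using N[OF that] by simp
      finally show ?thesis by (simp add: integral_nonneg_AE)
    qed
    thus "\<exists>N. \<forall>n\<ge>N. norm ((\<integral>\<omega>. norm (?u n \<omega>) \<partial>M) - 0) < e" by blast
  qed
  from tendsto_L1_AE_subseq[OF int this] obtain k where
    k: "strict_mono k" "AE \<omega> in M. (\<lambda>n. ?u (k n) \<omega>) \<longlonglongrightarrow> 0" by blast
  have "AE \<omega> in M. (\<lambda>n. Y (r (k n)) \<omega>) \<longlonglongrightarrow> Y t \<omega>"
    using k(2)
  proof (rule AE_mp, intro AE_I2 impI)
    fix \<omega> assume lim: "(\<lambda>n. ?u (k n) \<omega>) \<longlonglongrightarrow> 0"
    hence "\<forall>\<^sub>F n in sequentially. ?u (k n) \<omega> < 1"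
      by (rule order_tendstoD) simp
    hence "\<forall>\<^sub>F n in sequentially. ?u (k n) \<omega> = \<bar>Y (r (k n)) \<omega> - Y t \<omega>\<bar>"
      by eventually_elim auto
    with lim have "(\<lambda>n. \<bar>Y (r (k n)) \<omega> - Y t \<omega>\<bar>) \<longlonglongrightarrow> 0"
      using tendsto_cong by fastforce
    thus "(\<lambda>n. Y (r (k n)) \<omega>) \<longlonglongrightarrow> Y t \<omega>"
      using LIM_zero_cancel tendsto_rabs_zero_iff by blast
  qed
  thus ?thesis using k(1) that by blast
qed

text \<open>By multiplicativity in time the value at \<open>1 / b\<close> is a b-th root of
  \<open>m\<close>, and the value at \<open>a / b\<close> is the a-th power of that root.\<close>

lemma levy_nn_mgf_rational:
  assumes q: "q \<in> \<rat>" "q \<ge> 0"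
    and m: "m > 0" "(\<integral>\<^sup>+\<omega>. ennreal (exp (\<theta> * Y 1 \<omega>)) \<partial>M) = ennreal m"
  shows "(\<integral>\<^sup>+\<omega>. ennreal (exp (\<theta> * Y q \<omega>)) \<partial>M) = ennreal (m powr q)"
proof -
  define f where "f t = (\<integral>\<^sup>+\<omega>. ennreal (exp (\<theta> * Y t \<omega>)) \<partial>M)" for t
  have f0: "f 0 = 1"
  proof -
    have "f 0 = (\<integral>\<^sup>+\<omega>. 1 \<partial>M)" unfolding f_def
      using levy_zero by (intro nn_integral_cong_AE) auto
    thus ?thesis by (simp add: emeasure_space_1)
  qed
  have f_mult: "f (real n * s) = f s ^ n" if "s \<ge> 0" for n s
  proof (induction n)
    case (Suc n)
    have "f (real (Suc n) * s) = f (s + real n * s)" by (simp add: algebra_simps)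
    also have "\<dots> = f s * f (real n * s)"
      unfolding f_def using that by (intro levy_nn_mgf_add) auto
    finally show ?case using Suc by simp
  qed (simp add: f0)
  obtain a b :: nat where ab: "b > 0" "q = real a / real b"
    using q Rats_abs_nat_div_natE[of q] by (metis abs_of_nonneg gr0I)
  have b: "f (1 / b) ^ b = ennreal m"
    using f_mult[of "1 / b" b] ab m(2) by (simp add: f_def)
  \<comment> \<open>An infinite value would make the b-th power infinite as well, since
    \<open>b > 0\<close>.\<close>
  hence "f (1 / b) \<noteq> top"
    using ab(1) by (metis ennreal_neq_top power_eq_top_ennreal neq0_conv)
  then obtain c where c: "c \<ge> 0" "f (1 / b) = ennreal c"
    by (cases "f (1 / b)") auto
  have "c ^ b = m"
    using b c m(1) by (simp add: ennreal_power)
  have "c > 0"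
    using \<open>c ^ b = m\<close> c(1) m(1) ab(1) by (cases "c = 0") (auto simp: power_0_left)
  hence "m = c powr b"
    using \<open>c ^ b = m\<close> by (simp add: powr_realpow)
  hence c_eq: "c = m powr (1 / b)"
    using ab(1) \<open>c > 0\<close> by (simp add: powr_powr)
  have "f q = f (real a * (1 / b))" using ab by simp
  also have "\<dots> = ennreal (c ^ a)"
    using ab(1) c by (subst f_mult) (auto simp: ennreal_power)
  also have "c ^ a = m powr q"
    using m(1) ab by (simp add: c_eq powr_powr flip: powr_realpow)
  finally show ?thesis by (simp add: f_def)
qed

text \<open>Fatou's lemma along rational times gives \<open>E exp (\<theta> Y t) \<le> m powr t\<close>; completing \<open>t\<close> to a
  rational time by an independent increment turns this into an equality.\<close>

lemma levy_nn_mgf: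
  assumes t: "t \<ge> 0"
    and m: "m > 0" "(\<integral>\<^sup>+\<omega>. ennreal (exp (\<theta> * Y 1 \<omega>)) \<partial>M) = ennreal m"
  shows "(\<integral>\<^sup>+\<omega>. ennreal (exp (\<theta> * Y t \<omega>)) \<partial>M) = ennreal (m powr t)"
proof -
  define f where "f t = (\<integral>\<^sup>+\<omega>. ennreal (exp (\<theta> * Y t \<omega>)) \<partial>M)" for t
  have le: "f t \<le> ennreal (m powr t)" if t: "t \<ge> 0" for t
  proof -
    have "\<exists>r\<in>\<rat>. t < r \<and> r < t + 1 / Suc n" for n
      by (rule Rats_dense_in_real) auto
    then obtain r where r: "\<And>n. r n \<in> \<rat>" "\<And>n. t < r n" "\<And>n. r n < t + 1 / Suc n"
      by metis
    have lim: "r \<longlonglongrightarrow> t"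
    proof (rule tendsto_sandwich[OF _ _ tendsto_const])
      show "(\<lambda>n. t + 1 / Suc n) \<longlonglongrightarrow> t"
        using tendsto_add[OF tendsto_const LIMSEQ_inverse_real_of_nat, of t] by (simp add: divide_inverse)
    qed (use r in \<open>auto intro!: always_eventually less_imp_le\<close>)
    have r0: "r n \<ge> 0" for n using t r(2)[of n] by linarith
    obtain k where k: "strict_mono k" "AE \<omega> in M. (\<lambda>n. Y (r (k n)) \<omega>) \<longlonglongrightarrow> Y t \<omega>"
      using levy_AE_subseq[OF t r0 _ lim] r(2) by (metis less_irrefl)
    have [measurable]: "Y (r n) \<in> borel_measurable M" for n using r0 by (rule levy_measurable)
    have "f t = (\<integral>\<^sup>+\<omega>. liminf (\<lambda>n. ennreal (exp (\<theta> * Y (r (k n)) \<omega>))) \<partial>M)"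
      unfolding f_def
    proof (rule nn_integral_cong_AE, use k(2) in eventually_elim)
      case (elim \<omega>)
      have "(\<lambda>n. ennreal (exp (\<theta> * Y (r (k n)) \<omega>))) \<longlonglongrightarrow> ennreal (exp (\<theta> * Y t \<omega>))"
        by (intro tendsto_ennrealI tendsto_intros elim)
      thus ?case by (rule lim_imp_Liminf[OF sequentially_bot, symmetric])
    qed
    also have "\<dots> \<le> liminf (\<lambda>n. f (r (k n)))"
      unfolding f_def by (rule nn_integral_liminf) auto
    also have "\<dots> = liminf (\<lambda>n. ennreal (m powr r (k n)))"
      using levy_nn_mgf_rational[OF r(1) r0 m] by (simp add: f_def)
    also have "\<dots> = ennreal (m powr t)"
    proof (rule lim_imp_Liminf)
      have "(\<lambda>n. r (k n)) \<longlonglongrightarrow> t"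
        using LIMSEQ_subseq_LIMSEQ[OF lim k(1)] by (simp add: comp_def)
      thus "(\<lambda>n. ennreal (m powr r (k n))) \<longlonglongrightarrow> ennreal (m powr t)"
        using m(1) by (intro tendsto_ennrealI tendsto_intros) auto
    qed simp
    finally show ?thesis .
  qed
  obtain q where q: "q \<in> \<rat>" "t < q" using Rats_dense_in_real[of t "t + 1"] by auto
  define r where "r = q - t"
  have r: "r \<ge> 0" "t + r = q" using q by (auto simp: r_def)
  have "ennreal (m powr r) * ennreal (m powr t) = ennreal (m powr q)"
    using r by (auto simp: powr_add mult.commute simp flip: ennreal_mult)
  also have "\<dots> = f q"
    using levy_nn_mgf_rational[OF q(1) _ m] q t by (simp add: f_def)
  also have "\<dots> = f r * f t"
    unfolding f_def r(2)[symmetric] using levy_nn_mgf_add[OF t r(1)] by (simp add: mult.commute)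
  \<comment> \<open>The upper bound is applied to the factor \<open>f r\<close> alone. Cancelling
    the finite positive number \<open>m powr r\<close> then gives the lower bound for
    \<open>f t\<close>.\<close>
  also have "\<dots> \<le> ennreal (m powr r) * f t"
    using le[OF r(1)] by (intro mult_right_mono) auto
  finally have "ennreal (m powr t) \<le> f t"
    using m(1) by (subst (asm) ennreal_mult_le_mult_iff) auto
  with le[OF t] show ?thesis by (simp add: f_def)
qed

lemma levy_mgf:
  assumes t: "t \<ge> 0" and int: "integrable M (\<lambda>\<omega>. exp (\<theta> * Y 1 \<omega>))"
  shows "integrable M (\<lambda>\<omega>. exp (\<theta> * Y t \<omega>))"
    and "(\<integral>\<omega>. exp (\<theta> * Y t \<omega>) \<partial>M) = (\<integral>\<omega>. exp (\<theta> * Y 1 \<omega>) \<partial>M) powr t"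
proof -
  define m where "m = (\<integral>\<omega>. exp (\<theta> * Y 1 \<omega>) \<partial>M)"
  have [measurable]: "Y t \<in> borel_measurable M" using t by (rule levy_measurable)
  have "m \<ge> 0" unfolding m_def by simp
  moreover have "m \<noteq> 0"
  proof
    assume "m = 0"
    hence "AE \<omega> in M. exp (\<theta> * Y 1 \<omega>) = 0"
      unfolding m_def using int by (subst (asm) integral_nonneg_eq_0_iff_AE) auto
    thus False by (simp add: AE_False)
  qed
  ultimately have "m > 0" by simp
  moreover have "(\<integral>\<^sup>+\<omega>. ennreal (exp (\<theta> * Y 1 \<omega>)) \<partial>M) = ennreal m"
    unfolding m_def using int by (intro nn_integral_eq_integral) auto
  ultimately have *: "(\<integral>\<^sup>+\<omega>. ennreal (exp (\<theta> * Y t \<omega>)) \<partial>M) = ennreal (m powr t)"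
    by (rule levy_nn_mgf[OF t])
  show int: "integrable M (\<lambda>\<omega>. exp (\<theta> * Y t \<omega>))"
    by (rule integrableI_nonneg) (auto simp: *)
  show "(\<integral>\<omega>. exp (\<theta> * Y t \<omega>) \<partial>M) = (\<integral>\<omega>. exp (\<theta> * Y 1 \<omega>) \<partial>M) powr t"
    by (subst integral_eq_nn_integral) (auto simp: * m_def)
qed

end

section \<open>Scaling, time change and equality in law of Levy processes\<close>

lemma levy_process_scale:
  assumes M: "prob_space M" and Y: "levy_process M Y" and k: "k > 0"
  shows "levy_process M (\<lambda>t \<omega>. k * Y t \<omega>)"
  unfolding levy_process_def
proof (intro conjI allI impI)
  interpret prob_space M by (rule M)
  note [measurable] = levy_measurable[OF M Y]
  show "(\<lambda>\<omega>. k * Y t \<omega>) \<in> borel_measurable M" if "t \<ge> 0" for t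
    using that by measurable
  show "AE \<omega> in M. k * Y 0 \<omega> = 0"
    using levy_zero[OF M Y] by auto
  show "indep_vars (\<lambda>_. borel) (\<lambda>i \<omega>. k * Y (t (Suc i)) \<omega> - k * Y (t i) \<omega>) {..<n}"
    if "0 \<le> t 0" "\<forall>i<n. t i \<le> t (Suc i)" for n and t :: "nat \<Rightarrow> real"
  proof -
    have "indep_vars (\<lambda>_. borel) (\<lambda>i \<omega>. k * (Y (t (Suc i)) \<omega> - Y (t i) \<omega>)) {..<n}"
      by (rule indep_vars_compose2[OF levy_indep_increments[OF M Y]]) (use that in auto)
    thus ?thesis by (simp add: right_diff_distrib)
  qed
  show "distr M borel (\<lambda>\<omega>. k * Y (s + t) \<omega> - k * Y s \<omega>) = distr M borel (\<lambda>\<omega>. k * Y t \<omega>)"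
    if "s \<ge> 0" "t \<ge> 0" for s t
  proof -
    have "distr M borel (\<lambda>\<omega>. k * (Y (s + t) \<omega> - Y s \<omega>))
        = distr (distr M borel (\<lambda>\<omega>. Y (s + t) \<omega> - Y s \<omega>)) borel ((*) k)"
      using that by (subst distr_distr) (auto simp: comp_def)
    also have "distr M borel (\<lambda>\<omega>. Y (s + t) \<omega> - Y s \<omega>) = distr M borel (Y t)"
      using levy_stationary_increments[OF M Y, of s "s + t"] that by simp
    also have "distr (distr M borel (Y t)) borel ((*) k) = distr M borel (\<lambda>\<omega>. k * Y t \<omega>)"
      using that by (subst distr_distr) (auto simp: comp_def)
    finally show ?thesis by (simp add: right_diff_distrib)
  qed
  show "((\<lambda>s. measure M {\<omega> \<in> space M. \<bar>k * Y s \<omega> - k * Y t \<omega>\<bar> > e}) \<longlongrightarrow> 0) (at t within {0..})"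
    if "t \<ge> 0" "e > 0" for t e
  proof -
    have "\<bar>k * y - k * y'\<bar> > e \<longleftrightarrow> \<bar>y - y'\<bar> > e / k" for y y'
      unfolding right_diff_distrib[symmetric] abs_mult using k by (simp add: pos_divide_less_eq mult.commute)
    thus ?thesis
      using levy_continuous_in_probability[OF M Y, of t "e / k"] that k by simp
  qed
qed

lemma levy_process_time_change:
  assumes M: "prob_space M" and Y: "levy_process M Y" and c: "c > 0"
  shows "levy_process M (\<lambda>t. Y (c * t))"
  unfolding levy_process_def
proof (intro conjI allI impI)
  show "Y (c * t) \<in> borel_measurable M" if "t \<ge> 0" for t
    using that c by (intro levy_measurable[OF M Y]) simp
  show "AE \<omega> in M. Y (c * 0) \<omega> = 0"
    using levy_zero[OF M Y] by simp
  show "prob_space.indep_vars M (\<lambda>_. borel) (\<lambda>i \<omega>. Y (c * t (Suc i)) \<omega> - Y (c * t i) \<omega>) {..<n}"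
    if "0 \<le> t 0" "\<forall>i<n. t i \<le> t (Suc i)" for n and t :: "nat \<Rightarrow> real"
    using levy_indep_increments[OF M Y, of "\<lambda>i. c * t i" n] that c by auto
  show "distr M borel (\<lambda>\<omega>. Y (c * (s + t)) \<omega> - Y (c * s) \<omega>) = distr M borel (Y (c * t))"
    if "s \<ge> 0" "t \<ge> 0" for s t
    using levy_stationary_increments[OF M Y, of "c * s" "c * (s + t)"] that c
    by (simp add: algebra_simps)
  show "((\<lambda>s. measure M {\<omega> \<in> space M. \<bar>Y (c * s) \<omega> - Y (c * t) \<omega>\<bar> > e}) \<longlongrightarrow> 0) (at t within {0..})"
    if "t \<ge> 0" "e > 0" for t e
  proof (rule filterlim_compose[OF levy_continuous_in_probability[OF M Y, of "c * t" e]])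
    \<comment> \<open>Multiplication by \<open>c > 0\<close> carries punctured neighbourhoods of
      \<open>t\<close> in the half-line to punctured neighbourhoods of \<open>c * t\<close>.\<close>
    show "filterlim ((*) c) (at (c * t) within {0..}) (at t within {0..})"
      using c by (auto simp: filterlim_at eventually_at_filter intro!: tendsto_intros)
  qed (use that c in auto)
qed

text \<open>Both vectors are the same measurable image of the vector of successive increments, whose law
  is a product of one-dimensional marginals.\<close>

lemma levy_same_fdd:
  assumes M: "prob_space M" and Y: "levy_process M Y" and Z: "levy_process M Z"
    and eq: "\<And>t. t \<ge> 0 \<Longrightarrow> distr M borel (Y t) = distr M borel (Z t)"
  shows "same_fdd M Y Z"
  unfolding same_fdd_def
proof (intro allI impI)
  fix J :: "real set" assume J: "finite J" "J \<subseteq> {0..}"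
  interpret prob_space M by (rule M)
  show "distr M (Pi\<^sub>M J (\<lambda>_. borel)) (\<lambda>\<omega>. \<lambda>t\<in>J. Y t \<omega>) =
        distr M (Pi\<^sub>M J (\<lambda>_. borel)) (\<lambda>\<omega>. \<lambda>t\<in>J. Z t \<omega>)"
  \<comment> \<open>The characterisation of independence by a product law requires a nonempty index
    set.\<close>
  proof (cases "J = {}")
    case True
    thus ?thesis by (simp add: restrict_def)
  next
    case False
    define n where "n = card J"
    \<comment> \<open>Index 0 is the starting time 0 and index \<open>Suc j\<close> is the j-th
      element of \<open>J\<close> in increasing order, so \<open>n\<close> increments reach every
      time in \<open>J\<close>. The value 0 beyond the list keeps \<open>t\<close> nonnegative
      everywhere.\<close>
    define t where "t i = (case i of 0 \<Rightarrow> 0 | Suc j \<Rightarrow> if j < n then sorted_list_of_set J ! j else 0)" for i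
    have n: "{..<n} \<noteq> {}" using False J by (simp add: n_def card_gt_0_iff lessThan_empty_iff)
    have len: "length (sorted_list_of_set J) = n" by (simp add: n_def)
    have nth_J: "sorted_list_of_set J ! j \<in> J" if "j < n" for j
      using nth_mem[of j "sorted_list_of_set J"] that J(1) len by simp
    have t_nonneg: "t i \<ge> 0" for i
      using nth_J J(2) by (auto simp: t_def split: nat.split)
    have t_mono: "t i \<le> t (Suc i)" if "i < n" for i
    proof (cases i)
      case 0
      thus ?thesis using t_nonneg[of 1] by (simp add: t_def)
    next
      case (Suc j)
      thus ?thesis
        using that sorted_nth_mono[of "sorted_list_of_set J" j i] len by (simp add: t_def)
    qed
    have "\<exists>k\<le>n. t k = s" if s: "s \<in> J" for s
    proof -
      obtain j where "j < n" "sorted_list_of_set J ! j = s"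
        using s J(1) len in_set_conv_nth[of s "sorted_list_of_set J"] by auto
      thus ?thesis by (intro exI[of _ "Suc j"]) (auto simp: t_def)
    qed
    then obtain idx where idx: "\<And>s. s \<in> J \<Longrightarrow> idx s \<le> n" "\<And>s. s \<in> J \<Longrightarrow> t (idx s) = s"
      by metis
    \<comment> \<open>Partial sums of the increments recover the process at the times in
      \<open>J\<close>, where \<open>idx s\<close> is the position of \<open>s\<close> in the
      partition.\<close>
    define G where "G d = (\<lambda>s\<in>J. \<Sum>i<idx s. d i)" for d :: "nat \<Rightarrow> real"
    have G [measurable]: "G \<in> (Pi\<^sub>M {..<n} (\<lambda>_. borel)) \<rightarrow>\<^sub>M (Pi\<^sub>M J (\<lambda>_. borel))"
      unfolding G_def
      using idx(1) by (intro measurable_restrict borel_measurable_sum measurable_component_singleton) force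
    \<comment> \<open>The right-hand side involves only one-dimensional marginals of
      \<open>W\<close>, so it agrees for \<open>Y\<close> and \<open>Z\<close>.\<close>
    have law: "distr M (Pi\<^sub>M J (\<lambda>_. borel)) (\<lambda>\<omega>. \<lambda>t\<in>J. W t \<omega>)
        = distr (\<Pi>\<^sub>M i\<in>{..<n}. distr M borel (W (t (Suc i) - t i))) (Pi\<^sub>M J (\<lambda>_. borel)) G"
      if W: "levy_process M W" for W
    proof -
      note W_meas [measurable] = levy_measurable[OF M W]
      let ?D = "\<lambda>i \<omega>. W (t (Suc i)) \<omega> - W (t i) \<omega>"
      have [measurable]: "?D i \<in> borel_measurable M" for i
        using t_nonneg[of i] t_nonneg[of "Suc i"] by measurable
      have "distr M (Pi\<^sub>M {..<n} (\<lambda>_. borel)) (\<lambda>\<omega>. \<lambda>i\<in>{..<n}. ?D i \<omega>)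
          = (\<Pi>\<^sub>M i\<in>{..<n}. distr M borel (?D i))"
        using levy_indep_increments[OF M W, of t n] t_nonneg t_mono
        by (subst indep_vars_iff_distr_eq_PiM'[OF n, symmetric]) auto
      also have "\<dots> = (\<Pi>\<^sub>M i\<in>{..<n}. distr M borel (W (t (Suc i) - t i)))"
        using levy_stationary_increments[OF M W t_nonneg t_mono] by (intro PiM_cong) auto
      finally have incr: "distr M (Pi\<^sub>M {..<n} (\<lambda>_. borel)) (\<lambda>\<omega>. \<lambda>i\<in>{..<n}. ?D i \<omega>)
          = (\<Pi>\<^sub>M i\<in>{..<n}. distr M borel (W (t (Suc i) - t i)))" .
      have "distr M (Pi\<^sub>M J (\<lambda>_. borel)) (\<lambda>\<omega>. \<lambda>t\<in>J. W t \<omega>)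
          = distr M (Pi\<^sub>M J (\<lambda>_. borel)) (\<lambda>\<omega>. G (\<lambda>i\<in>{..<n}. ?D i \<omega>))"
      proof (rule distr_cong_AE)
        show "AE \<omega> in M. (\<lambda>t\<in>J. W t \<omega>) = G (\<lambda>i\<in>{..<n}. ?D i \<omega>)"
          using levy_zero[OF M W]
        proof eventually_elim
          case (elim \<omega>)
          have "W s \<omega> = (\<Sum>i<idx s. (\<lambda>i\<in>{..<n}. ?D i \<omega>) i)" if "s \<in> J" for s
          proof -
            have "(\<Sum>i<idx s. (\<lambda>i\<in>{..<n}. ?D i \<omega>) i) = (\<Sum>i<idx s. ?D i \<omega>)"
              using idx(1)[OF that] by (intro sum.cong) auto
            also have "\<dots> = W (t (idx s)) \<omega> - W (t 0) \<omega>"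
              by (rule sum_lessThan_telescope)
            finally show ?thesis using idx(2)[OF that] elim by (simp add: t_def)
          qed
          thus ?case by (auto simp: G_def restrict_def)
        qed
        show "(\<lambda>\<omega>. \<lambda>t\<in>J. W t \<omega>) \<in> M \<rightarrow>\<^sub>M Pi\<^sub>M J (\<lambda>_. borel)"
          using J(2) by (intro measurable_restrict) auto
        show "(\<lambda>\<omega>. G (\<lambda>i\<in>{..<n}. ?D i \<omega>)) \<in> M \<rightarrow>\<^sub>M Pi\<^sub>M J (\<lambda>_. borel)"
          by measurable
      qed simp_all
      also have "\<dots> = distr (distr M (Pi\<^sub>M {..<n} (\<lambda>_. borel)) (\<lambda>\<omega>. \<lambda>i\<in>{..<n}. ?D i \<omega>)) (Pi\<^sub>M J (\<lambda>_. borel)) G"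
        by (subst distr_distr) (auto simp: comp_def)
      finally show ?thesis unfolding incr .
    qed
    have "(\<Pi>\<^sub>M i\<in>{..<n}. distr M borel (Y (t (Suc i) - t i)))
        = (\<Pi>\<^sub>M i\<in>{..<n}. distr M borel (Z (t (Suc i) - t i)))"
      using eq t_mono by (intro PiM_cong) auto
    thus ?thesis by (simp add: law[OF Y] law[OF Z])
  qed
qed

section \<open>Natural exponential families\<close>

lemma tendsto_SUP_within:
  fixes f :: "real \<Rightarrow> ereal"
  assumes mono: "\<And>s s'. s \<in> I \<Longrightarrow> s' \<in> I \<Longrightarrow> s \<le> s' \<Longrightarrow> f s \<le> f s'" and ub: "\<And>s. s \<in> I \<Longrightarrow> s < \<theta>"
  shows "(f \<longlongrightarrow> (SUP s\<in>I. f s)) (at \<theta> within I)"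
proof (rule order_tendstoI)
  fix a assume "a < (SUP s\<in>I. f s)"
  then obtain s where s: "s \<in> I" "a < f s" by (auto simp: less_SUP_iff)
  have "\<forall>\<^sub>F x in at \<theta> within I. x > s"
    using ub[OF s(1)] by (intro order_tendstoD(1)[OF tendsto_ident_at])
  moreover have "\<forall>\<^sub>F x in at \<theta> within I. x \<in> I"
    by (simp add: eventually_at_filter)
  ultimately show "\<forall>\<^sub>F x in at \<theta> within I. a < f x"
  proof eventually_elim
    case (elim x)
    thus ?case using mono[OF s(1), of x] s(2) by (auto intro: less_le_trans)
  qed
next
  fix a assume "(SUP s\<in>I. f s) < a"
  hence "\<And>s. s \<in> I \<Longrightarrow> f s < a" by (meson SUP_upper le_less_trans)
  thus "\<forall>\<^sub>F x in at \<theta> within I. f x < a"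
    by (simp add: eventually_at_filter)
qed

lemma tendsto_INF_within:
  fixes f :: "real \<Rightarrow> ereal"
  assumes mono: "\<And>s s'. s \<in> I \<Longrightarrow> s' \<in> I \<Longrightarrow> s \<le> s' \<Longrightarrow> f s \<le> f s'" and lb: "\<And>s. s \<in> I \<Longrightarrow> \<theta> < s"
  shows "(f \<longlongrightarrow> (INF s\<in>I. f s)) (at \<theta> within I)"
proof (rule order_tendstoI)
  fix a assume "(INF s\<in>I. f s) < a"
  then obtain s where s: "s \<in> I" "f s < a" by (auto simp: INF_less_iff)
  have "\<forall>\<^sub>F x in at \<theta> within I. x < s"
    using lb[OF s(1)] by (intro order_tendstoD(2)[OF tendsto_ident_at])
  moreover have "\<forall>\<^sub>F x in at \<theta> within I. x \<in> I"
    by (simp add: eventually_at_filter)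
  ultimately show "\<forall>\<^sub>F x in at \<theta> within I. f x < a"
  proof eventually_elim
    case (elim x)
    thus ?case using mono[OF _ s(1), of x] s(2) by (auto intro: le_less_trans)
  qed
next
  fix a assume "a < (INF s\<in>I. f s)"
  hence "\<And>s. s \<in> I \<Longrightarrow> a < f s" by (meson INF_lower less_le_trans)
  thus "\<forall>\<^sub>F x in at \<theta> within I. a < f x"
    by (simp add: eventually_at_filter)
qed

section \<open>The mean map of a natural exponential family and its boundary values\<close>

locale exp_family_generator =
  fixes P :: "real measure"
  assumes prob_P: "prob_space P" and sets_P: "sets P = sets borel"
    and nondegenerate: "\<not> (\<exists>a. AE x in P. x = a)"
    and interior_nonempty: "interior (cgf_domain P) \<noteq> {}"
begin

abbreviation "nat_params \<equiv> interior (cgf_domain P)"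

abbreviation "means \<equiv> tilt_mean P ` nat_params"

lemma nat_params_subset: "\<theta> \<in> nat_params \<Longrightarrow> \<theta> \<in> cgf_domain P"
  using interior_subset by blast

lemma convex_nat_params: "convex nat_params"
  by (intro convex_interior convex_cgf_domain sets_P)

lemma variance_pos: "\<theta> \<in> nat_params \<Longrightarrow> tilt_variance P \<theta> > 0"
  by (rule tilt_variance_pos[OF prob_P sets_P nondegenerate])

lemma DERIV_mean: "\<theta> \<in> nat_params \<Longrightarrow> (tilt_mean P has_field_derivative tilt_variance P \<theta>) (at \<theta>)"
  by (rule has_field_derivative_tilt_mean[OF prob_P sets_P])

lemma DERIV_cgf: "\<theta> \<in> nat_params \<Longrightarrow> (cgf P has_field_derivative tilt_mean P \<theta>) (at \<theta>)"
  by (rule has_field_derivative_cgf[OF prob_P sets_P])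

lemma mean_strict_mono:
  assumes "s \<in> nat_params" "s' \<in> nat_params" "s < s'"
  shows "tilt_mean P s < tilt_mean P s'"
proof (rule DERIV_pos_imp_increasing[OF assms(3)])
  fix x assume "s \<le> x" "x \<le> s'"
  hence "x \<in> nat_params"
    using mem_is_interval_1_I[OF _ assms(1,2)] convex_nat_params by (simp add: is_interval_convex_1)
  thus "\<exists>y. (tilt_mean P has_real_derivative y) (at x) \<and> 0 < y"
    using DERIV_mean variance_pos by blast
qed

lemma mean_inj: "inj_on (tilt_mean P) nat_params"
  by (rule linorder_inj_onI') (use mean_strict_mono in force)

lemma mean_continuous: "continuous_on nat_params (tilt_mean P)"
  using DERIV_mean by (meson DERIV_isCont continuous_at_imp_continuous_on)

lemma convex_means: "convex means"
  using connected_continuous_image[OF mean_continuous convex_connected[OF convex_nat_params]]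
  by (simp add: connected_convex_1)

text \<open>By strict monotonicity every mean lies strictly between the means of two nearby
  parameters, and everything between these is a mean because the means form an interval.\<close>

lemma open_means: "open means"
  unfolding open_subopen[of means]
proof
  fix y assume "y \<in> means"
  then obtain \<theta> where \<theta>: "\<theta> \<in> nat_params" "y = tilt_mean P \<theta>" by blast
  obtain e where e: "e > 0" "cball \<theta> e \<subseteq> nat_params"
    using open_contains_cball[of nat_params] \<theta>(1) by auto
  have e': "\<theta> - e \<in> nat_params" "\<theta> + e \<in> nat_params"
    using e(1) by (auto simp: dist_real_def intro!: subsetD[OF e(2)])
  have "y \<in> {tilt_mean P (\<theta> - e)<..<tilt_mean P (\<theta> + e)}"
    using mean_strict_mono[OF e'(1) \<theta>(1)] mean_strict_mono[OF \<theta>(1) e'(2)] \<theta>(2) e(1) by simp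
  moreover have "{tilt_mean P (\<theta> - e)<..<tilt_mean P (\<theta> + e)} \<subseteq> means"
  proof
    fix z assume "z \<in> {tilt_mean P (\<theta> - e)<..<tilt_mean P (\<theta> + e)}"
    thus "z \<in> means"
      by (intro mem_is_interval_1_I[OF convex_means[folded is_interval_convex_1] imageI[OF e'(1)] imageI[OF e'(2)]]) auto
  qed
  ultimately show "\<exists>T. open T \<and> y \<in> T \<and> T \<subseteq> means"
    using open_greaterThanLessThan by blast
qed

lemma cgf_deriv_interior: "\<theta> \<in> nat_params \<Longrightarrow> cgf_deriv P \<theta> = ereal (tilt_mean P \<theta>)"
  by (simp add: cgf_deriv_def deriv_cgf prob_P sets_P)

lemma endpoint_cases:
  assumes "\<theta> \<in> cgf_domain P - nat_params"
  obtains "\<And>s. s \<in> nat_params \<Longrightarrow> s < \<theta>" | "\<And>s. s \<in> nat_params \<Longrightarrow> \<theta> < s"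
proof -
  have "(\<forall>s\<in>nat_params. s < \<theta>) \<or> (\<forall>s\<in>nat_params. \<theta> < s)"
  proof (rule ccontr)
    assume "\<not> ?thesis"
    then obtain s s' where "s \<in> nat_params" "s' \<in> nat_params" "s \<le> \<theta>" "\<theta> \<le> s'"
      by (meson not_less)
    hence "\<theta> \<in> nat_params"
      using mem_is_interval_1_I[of nat_params s s'] convex_nat_params by (simp add: is_interval_convex_1)
    thus False using assms by simp
  qed
  thus ?thesis using that by blast
qed

lemma endpoint_closure:
  assumes "\<theta> \<in> cgf_domain P"
  shows "\<theta> \<in> closure nat_params"
  using assms convex_closure_interior[OF convex_cgf_domain[OF sets_P] interior_nonempty] closure_subset
  by blast

lemma endpoint_at_nontrivial:
  assumes "\<theta> \<in> cgf_domain P - nat_params"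
  shows "at \<theta> within nat_params \<noteq> bot"
  using endpoint_closure assms by (auto simp: closure_def trivial_limit_within)

text \<open>The value \<open>Lim\<close> in \<open>cgf_deriv\<close> is informative only once a
  limit exists. Monotonicity of the mean provides one in the extended reals, and it is unique
  because the endpoint is an accumulation point of the interior.\<close>

lemma cgf_deriv_endpoint:
  assumes \<theta>: "\<theta> \<in> cgf_domain P - nat_params"
  shows "((\<lambda>s. ereal (tilt_mean P s)) \<longlongrightarrow> cgf_deriv P \<theta>) (at \<theta> within nat_params)"
proof -
  have mono: "ereal (tilt_mean P s) \<le> ereal (tilt_mean P s')"
    if "s \<in> nat_params" "s' \<in> nat_params" "s \<le> s'" for s s'
    using mean_strict_mono[of s s'] that by (cases "s = s'") auto
  obtain L where L: "((\<lambda>s. ereal (tilt_mean P s)) \<longlongrightarrow> L) (at \<theta> within nat_params)"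
  proof (rule endpoint_cases[OF \<theta>])
    assume "\<And>s. s \<in> nat_params \<Longrightarrow> s < \<theta>"
    from that[OF tendsto_SUP_within[OF mono this]] show thesis by simp
  next
    assume "\<And>s. s \<in> nat_params \<Longrightarrow> \<theta> < s"
    from that[OF tendsto_INF_within[OF mono this]] show thesis by simp
  qed
  have "((\<lambda>s. ereal (deriv (cgf P) s)) \<longlongrightarrow> L) (at \<theta> within nat_params)"
    using L by (rule Lim_transform_eventually)
      (simp add: eventually_at_filter deriv_cgf prob_P sets_P)
  hence "cgf_deriv P \<theta> = L"
    using \<theta> endpoint_at_nontrivial[OF \<theta>] by (simp add: cgf_deriv_def tendsto_Lim)
  thus ?thesis using L by simp
qed

text \<open>A finite mean attached to an endpoint is a limit of elements of the open interval of interior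
  means, so it disappears when the interior is taken.\<close>

lemma domain_interior_eq_means: "domain_interior (cgf_deriv P ` cgf_domain P) = means"
proof -
  let ?S = "{x. ereal x \<in> cgf_deriv P ` cgf_domain P}"
  have "means \<subseteq> ?S"
    using cgf_deriv_interior nat_params_subset by (force simp: image_iff)
  hence "means \<subseteq> interior ?S" by (rule interior_maximal[OF _ open_means])
  moreover have "?S \<subseteq> closure means"
  proof
    fix x assume "x \<in> ?S"
    then obtain \<theta> where \<theta>: "\<theta> \<in> cgf_domain P" "ereal x = cgf_deriv P \<theta>" by auto
    show "x \<in> closure means"
    proof (cases "\<theta> \<in> nat_params")
      case True
      thus ?thesis using \<theta> cgf_deriv_interior closure_subset by force
    next
      case False
      have "((\<lambda>s. ereal (tilt_mean P s)) \<longlongrightarrow> ereal x) (at \<theta> within nat_params)"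
        using cgf_deriv_endpoint[of \<theta>] \<theta> False by simp
      hence "(tilt_mean P \<longlongrightarrow> x) (at \<theta> within nat_params)" by (simp only: lim_ereal)
      moreover have "\<forall>\<^sub>F s in at \<theta> within nat_params. tilt_mean P s \<in> closure means"
        unfolding eventually_at_filter
        by (rule always_eventually) (use closure_subset[of means] in fast)
      ultimately show ?thesis
        using Lim_in_closed_set[OF closed_closure] endpoint_at_nontrivial[of \<theta>] \<theta> False by blast
    qed
  qed
  \<comment> \<open>An open convex set is the interior of its closure.\<close>
  hence "interior ?S \<subseteq> interior (closure means)" by (rule interior_mono)
  hence "interior ?S \<subseteq> means"
    using convex_interior_closure[OF convex_means] open_means by (simp add: interior_open)
  ultimately show ?thesis by (simp add: domain_interior_def)
qed

text \<open>The substitution \<open>\<theta> \<mapsto> \<tau> (a m(\<theta>))\<close>, with \<open>\<tau>\<close> the inverse of the mean map \<open>m\<close>, has constant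
  derivative \<open>r\<close> by the homogeneity of the variance, so it is affine.\<close>

lemma affine_scaling:
  assumes a: "a > 0" and r: "r > 0"
    and scale: "\<And>\<mu>. \<mu> \<in> means \<Longrightarrow> a * \<mu> \<in> means" "\<And>\<mu>. \<mu> \<in> means \<Longrightarrow> \<mu> / a \<in> means"
    and hom: "\<And>\<theta> \<theta>'. \<theta> \<in> nat_params \<Longrightarrow> \<theta>' \<in> nat_params \<Longrightarrow> tilt_mean P \<theta>' = a * tilt_mean P \<theta>
      \<Longrightarrow> tilt_variance P \<theta>' * r = a * tilt_variance P \<theta>"
  obtains b d where "(\<lambda>\<theta>. r * \<theta> + b) ` nat_params = nat_params"
    "\<And>\<theta>. \<theta> \<in> nat_params \<Longrightarrow> tilt_mean P (r * \<theta> + b) = a * tilt_mean P \<theta>"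
    "\<And>\<theta>. \<theta> \<in> nat_params \<Longrightarrow> cgf P (r * \<theta> + b) = r * a * cgf P \<theta> + d"
proof -
  define \<tau> where "\<tau> = inv_into nat_params (tilt_mean P)"
  define T where "T \<theta> = \<tau> (a * tilt_mean P \<theta>)" for \<theta>
  have \<tau>_mean: "\<tau> (tilt_mean P \<theta>) = \<theta>" if "\<theta> \<in> nat_params" for \<theta>
    unfolding \<tau>_def using mean_inj that by (rule inv_into_f_f)
  have T: "T \<theta> \<in> nat_params" "tilt_mean P (T \<theta>) = a * tilt_mean P \<theta>" if "\<theta> \<in> nat_params" for \<theta>
    using inv_into_into[OF scale(1)] f_inv_into_f[OF scale(1)] that by (auto simp: T_def \<tau>_def)
  have T_deriv: "(T has_field_derivative r) (at \<theta>)" if \<theta>: "\<theta> \<in> nat_params" for \<theta>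
  proof -
    \<comment> \<open>Inverse function theorem: the mean map has derivative
      \<open>tilt_variance\<close>, so \<tau> has the reciprocal derivative. With the chain rule,
      \<open>hom\<close> collapses the derivative of \<open>T\<close> to \<open>r\<close>.\<close>
    have "(\<tau> has_field_derivative inverse (tilt_variance P (T \<theta>))) (at (tilt_mean P (T \<theta>)))"
      using variance_pos[OF T(1)[OF \<theta>]] mean_continuous \<tau>_mean T(1)[OF \<theta>]
      by (intro has_field_derivative_inverse_strong[where S = nat_params, OF DERIV_mean]) auto
    hence "(T has_field_derivative inverse (tilt_variance P (T \<theta>)) * (a * tilt_variance P \<theta>)) (at \<theta>)"
      unfolding T_def[abs_def] T(2)[OF \<theta>, unfolded T_def]
      by (rule DERIV_chain2) (intro DERIV_cmult DERIV_mean \<theta>)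
    also have "inverse (tilt_variance P (T \<theta>)) * (a * tilt_variance P \<theta>) = r"
      using hom[OF \<theta> T[OF \<theta>]] variance_pos[OF T(1)[OF \<theta>]] by (simp add: field_simps)
    finally show ?thesis .
  qed
  have "((\<lambda>\<theta>. T \<theta> - r * \<theta>) has_field_derivative 0) (at \<theta> within nat_params)" if "\<theta> \<in> nat_params" for \<theta>
    using that by (auto intro!: derivative_eq_intros has_field_derivative_at_within[OF T_deriv])
  then obtain b where b: "\<And>\<theta>. \<theta> \<in> nat_params \<Longrightarrow> T \<theta> - r * \<theta> = b"
    using has_field_derivative_zero_constant[OF convex_nat_params, of "\<lambda>\<theta>. T \<theta> - r * \<theta>"] by blast
  have T_eq: "r * \<theta> + b = T \<theta>" if "\<theta> \<in> nat_params" for \<theta>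
    using b[OF that] by simp
  \<comment> \<open>Surjectivity is where stability of the means under division by \<open>a\<close>
    enters.\<close>
  have "nat_params \<subseteq> T ` nat_params"
  proof
    fix \<theta> assume \<theta>: "\<theta> \<in> nat_params"
    then obtain \<theta>' where \<theta>': "\<theta>' \<in> nat_params" "tilt_mean P \<theta> / a = tilt_mean P \<theta>'"
      using scale(2)[of "tilt_mean P \<theta>"] by auto
    hence "a * tilt_mean P \<theta>' = tilt_mean P \<theta>" using a by (simp add: field_simps)
    hence "T \<theta>' = \<theta>" using \<tau>_mean[OF \<theta>] by (simp add: T_def)
    thus "\<theta> \<in> T ` nat_params" using \<theta>'(1) by blast
  qed
  hence 1: "(\<lambda>\<theta>. r * \<theta> + b) ` nat_params = nat_params"
    using T(1) T_eq by (force simp: image_iff)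
  have 2: "tilt_mean P (r * \<theta> + b) = a * tilt_mean P \<theta>" if "\<theta> \<in> nat_params" for \<theta>
    using T_eq T(2) that by simp
  \<comment> \<open>The relation between the means is integrated once more; the chain rule
    contributes the factor \<open>r\<close>, and \<open>d\<close> is the integration
    constant.\<close>
  have "((\<lambda>\<theta>. cgf P (r * \<theta> + b) - r * a * cgf P \<theta>) has_field_derivative 0) (at \<theta> within nat_params)"
    if \<theta>: "\<theta> \<in> nat_params" for \<theta>
  proof -
    have "(cgf P has_field_derivative a * tilt_mean P \<theta>) (at (r * \<theta> + b))"
      using DERIV_cgf[of "r * \<theta> + b"] 2[OF \<theta>] T_eq T(1) \<theta> by simp
    moreover have "((\<lambda>\<theta>. r * \<theta> + b) has_field_derivative r) (at \<theta>)"
      by (auto intro!: derivative_eq_intros)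
    ultimately have "((\<lambda>\<theta>. cgf P (r * \<theta> + b)) has_field_derivative a * tilt_mean P \<theta> * r) (at \<theta>)"
      by (rule DERIV_chain2)
    from DERIV_diff[OF this DERIV_cmult[OF DERIV_cgf[OF \<theta>], of "r * a"]] show ?thesis
      by (simp add: mult_ac has_field_derivative_at_within)
  qed
  then obtain d where "\<And>\<theta>. \<theta> \<in> nat_params \<Longrightarrow> cgf P (r * \<theta> + b) - r * a * cgf P \<theta> = d"
    using has_field_derivative_zero_constant[OF convex_nat_params, of "\<lambda>\<theta>. cgf P (r * \<theta> + b) - r * a * cgf P \<theta>"]
    by blast
  hence "cgf P (r * \<theta> + b) = r * a * cgf P \<theta> + d" if "\<theta> \<in> nat_params" for \<theta>
    using that by (simp add: algebra_simps)
  from that[OF 1 2 this] show ?thesis .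
qed

text \<open>An increasing affine bijection of the open interval \<open>nat_params\<close> fixes its finite endpoints.\<close>

lemma affine_scaling_cgf_deriv:
  assumes a: "a > 0" and r: "r > 0"
    and onto: "(\<lambda>\<theta>. r * \<theta> + b) ` nat_params = nat_params"
    and mean: "\<And>\<theta>. \<theta> \<in> nat_params \<Longrightarrow> tilt_mean P (r * \<theta> + b) = a * tilt_mean P \<theta>"
    and \<theta>: "\<theta> \<in> cgf_domain P"
  shows "r * \<theta> + b \<in> cgf_domain P" "cgf_deriv P (r * \<theta> + b) = cgf_deriv P \<theta> * ereal a"
proof -
  have "r * \<theta> + b \<in> cgf_domain P \<and> cgf_deriv P (r * \<theta> + b) = cgf_deriv P \<theta> * ereal a"
  proof (cases "\<theta> \<in> nat_params")
    case True
    hence "r * \<theta> + b \<in> nat_params" using onto by blast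
    thus ?thesis using True mean nat_params_subset by (simp add: cgf_deriv_interior mult.commute)
  next
    case False
    hence \<theta>': "\<theta> \<in> cgf_domain P - nat_params" using \<theta> by simp
    have cl: "\<theta> \<in> X" if "closed X" "nat_params \<subseteq> X" for X
      using closure_minimal[OF that(2,1)] endpoint_closure[OF \<theta>] by blast
    have in_range: "r * s + b \<in> nat_params" if "s \<in> nat_params" for s using onto that by blast
    have preim: "\<exists>s'\<in>nat_params. s = r * s' + b" if "s \<in> nat_params" for s using onto that by blast
    \<comment> \<open>Since the interior is mapped into itself and onto itself, each of the two
      inequalities holds on the interior and passes to its closure, which contains \<theta>.\<close>
    have fixed: "r * \<theta> + b = \<theta>"
    proof (rule endpoint_cases[OF \<theta>'])
      assume ub: "\<And>s. s \<in> nat_params \<Longrightarrow> s < \<theta>"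
      have "\<theta> \<in> {x. r * x + b \<le> \<theta>}"
        using ub[OF in_range] by (intro cl closed_Collect_le continuous_intros) (auto intro: less_imp_le)
      moreover have "\<theta> \<in> {x. x \<le> r * \<theta> + b}"
        using preim ub r by (intro cl closed_Collect_le continuous_intros) (fastforce intro: less_imp_le)
      ultimately show ?thesis by simp
    next
      assume lb: "\<And>s. s \<in> nat_params \<Longrightarrow> \<theta> < s"
      have "\<theta> \<in> {x. \<theta> \<le> r * x + b}"
        using lb[OF in_range] by (intro cl closed_Collect_le continuous_intros) (auto intro: less_imp_le)
      moreover have "\<theta> \<in> {x. r * \<theta> + b \<le> x}"
        using preim lb r by (intro cl closed_Collect_le continuous_intros) (fastforce intro: less_imp_le)
      ultimately show ?thesis by simp
    qed
    have "filterlim (\<lambda>s. r * s + b) (at \<theta> within nat_params) (at \<theta> within nat_params)"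
    proof -
      have "((\<lambda>s. r * s + b) \<longlongrightarrow> r * \<theta> + b) (at \<theta> within nat_params)"
        by (intro tendsto_intros)
      moreover have "\<forall>\<^sub>F s in at \<theta> within nat_params. r * s + b \<in> nat_params \<and> r * s + b \<noteq> \<theta>"
        unfolding eventually_at_filter by (rule always_eventually) (use in_range False in metis)
      ultimately show ?thesis by (simp add: fixed filterlim_at)
    qed
    from filterlim_compose[OF cgf_deriv_endpoint[OF \<theta>'] this]
    have "((\<lambda>s. ereal (tilt_mean P (r * s + b))) \<longlongrightarrow> cgf_deriv P \<theta>) (at \<theta> within nat_params)" .
    moreover have "((\<lambda>s. ereal a * ereal (tilt_mean P s)) \<longlongrightarrow> ereal a * cgf_deriv P \<theta>) (at \<theta> within nat_params)"
      using a cgf_deriv_endpoint[OF \<theta>'] by (intro tendsto_cmult_ereal) auto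
    hence "((\<lambda>s. ereal (tilt_mean P (r * s + b))) \<longlongrightarrow> ereal a * cgf_deriv P \<theta>) (at \<theta> within nat_params)"
      by (rule Lim_transform_eventually) (auto simp: eventually_at_filter mean)
    \<comment> \<open>The same function tends both to the endpoint value and to \<open>a\<close>
      times it. As the endpoint is fixed, this equality of limits is the claim.\<close>
    ultimately have "cgf_deriv P \<theta> = ereal a * cgf_deriv P \<theta>"
      using tendsto_unique[OF endpoint_at_nontrivial[OF \<theta>']] by blast
    thus ?thesis unfolding fixed using \<theta> by (metis mult.commute)
  qed
  thus "r * \<theta> + b \<in> cgf_domain P" "cgf_deriv P (r * \<theta> + b) = cgf_deriv P \<theta> * ereal a" by auto
qed

end

section \<open>Gaussian laws and constant variance\<close>

lemma DERIV_compose_affine: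
  fixes f :: "real \<Rightarrow> real"
  assumes "(f has_field_derivative D) (at (x + k * s))"
  shows "((\<lambda>s. f (x + k * s)) has_field_derivative D * k) (at s)"
  by (rule DERIV_chain2[where g = "\<lambda>s. x + k * s", OF assms]) (auto intro!: derivative_eq_intros)

text \<open>Completing the square: multiplying the normal density by \<open>exp (s * x)\<close>
  moves its mean by \<open>\<sigma>\<^sup>2 * s\<close> and leaves a factor independent of
  \<open>x\<close>.\<close>

lemma exp_moment_normal:
  fixes b \<sigma> :: real
  assumes \<sigma>: "\<sigma> > 0"
  defines "N \<equiv> density lborel (normal_density b \<sigma>)"
  shows "cgf_domain N = UNIV" "real_exp_moment N 0 s = exp (b * s + \<sigma>\<^sup>2 * s\<^sup>2 / 2)"
proof -
  have eq: "normal_density b \<sigma> x * exp (s * x)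
      = exp (b * s + \<sigma>\<^sup>2 * s\<^sup>2 / 2) * normal_density (b + \<sigma>\<^sup>2 * s) \<sigma> x" for s x
  proof -
    have "- (x - b)\<^sup>2 / (2 * \<sigma>\<^sup>2) + s * x
        = b * s + \<sigma>\<^sup>2 * s\<^sup>2 / 2 + - (x - (b + \<sigma>\<^sup>2 * s))\<^sup>2 / (2 * \<sigma>\<^sup>2)"
      using \<sigma> by (simp add: field_simps power2_eq_square)
    hence "exp (- (x - b)\<^sup>2 / (2 * \<sigma>\<^sup>2)) * exp (s * x)
        = exp (b * s + \<sigma>\<^sup>2 * s\<^sup>2 / 2) * exp (- (x - (b + \<sigma>\<^sup>2 * s))\<^sup>2 / (2 * \<sigma>\<^sup>2))"
      unfolding exp_add[symmetric] by (rule arg_cong)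
    thus ?thesis by (simp add: normal_density_def)
  qed
  have "integrable N (\<lambda>x. exp (s * x))" for s
  proof -
    have "integrable lborel (\<lambda>x. normal_density b \<sigma> x * exp (s * x))"
      unfolding eq using \<sigma> by simp
    thus ?thesis unfolding N_def by (subst integrable_real_density) auto
  qed
  thus "cgf_domain N = UNIV" by (auto simp: cgf_domain_def)
  have "real_exp_moment N 0 s = (\<integral>x. normal_density b \<sigma> x * exp (s * x) \<partial>lborel)"
    unfolding real_exp_moment_def N_def by (subst integral_real_density) auto
  also have "\<dots> = exp (b * s + \<sigma>\<^sup>2 * s\<^sup>2 / 2)"
    unfolding eq using \<sigma> by simp
  finally show "real_exp_moment N 0 s = exp (b * s + \<sigma>\<^sup>2 * s\<^sup>2 / 2)" .
qed

context exp_family_generator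
begin

text \<open>A constant variance makes the cumulant function quadratic, hence \<open>P\<close> Gaussian.\<close>

lemma constant_variance_means:
  assumes w: "w > 0" and const: "\<And>\<theta>. \<theta> \<in> nat_params \<Longrightarrow> tilt_variance P \<theta> = w"
  shows "means = UNIV"
proof -
  have "((\<lambda>\<theta>. tilt_mean P \<theta> - w * \<theta>) has_field_derivative 0) (at \<theta> within nat_params)"
    if \<theta>: "\<theta> \<in> nat_params" for \<theta>
  proof -
    have "((\<lambda>\<theta>. tilt_mean P \<theta> - w * \<theta>) has_field_derivative w - w * 1) (at \<theta>)"
      using DERIV_mean[OF \<theta>] const[OF \<theta>] by (intro DERIV_diff DERIV_cmult DERIV_ident) simp
    thus ?thesis by (simp add: has_field_derivative_at_within)
  qed
  then obtain b where b: "\<And>\<theta>. \<theta> \<in> nat_params \<Longrightarrow> tilt_mean P \<theta> - w * \<theta> = b"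
    using has_field_derivative_zero_constant[OF convex_nat_params, of "\<lambda>\<theta>. tilt_mean P \<theta> - w * \<theta>"] by blast
  have mean: "tilt_mean P \<theta> = b + w * \<theta>" if "\<theta> \<in> nat_params" for \<theta>
    using b[OF that] by simp
  have "((\<lambda>\<theta>. cgf P \<theta> - (b * \<theta> + w * \<theta>\<^sup>2 / 2)) has_field_derivative 0) (at \<theta> within nat_params)"
    if \<theta>: "\<theta> \<in> nat_params" for \<theta>
  proof -
    have "((\<lambda>\<theta>. b * \<theta> + w * \<theta>\<^sup>2 / 2) has_field_derivative b + w * \<theta>) (at \<theta>)"
      by (auto intro!: derivative_eq_intros)
    from DERIV_diff[OF DERIV_cgf[OF \<theta>] this] show ?thesis
      by (simp add: mean[OF \<theta>] has_field_derivative_at_within)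
  qed
  then obtain d where d: "\<And>\<theta>. \<theta> \<in> nat_params \<Longrightarrow> cgf P \<theta> - (b * \<theta> + w * \<theta>\<^sup>2 / 2) = d"
    using has_field_derivative_zero_constant[OF convex_nat_params, of "\<lambda>\<theta>. cgf P \<theta> - (b * \<theta> + w * \<theta>\<^sup>2 / 2)"]
    by blast
  define N where "N = density lborel (normal_density b (sqrt w))"
  have N: "cgf_domain N = UNIV" "real_exp_moment N 0 s = exp (b * s + w * s\<^sup>2 / 2)" for s
    using exp_moment_normal[of "sqrt w" b] w by (auto simp: N_def)
  have "P = N"
  proof (rule exp_moment_unique[OF prob_P sets_P])
    show "prob_space N" unfolding N_def using w by (intro prob_space_normal_density) simp
    show "sets N = sets borel" by (simp add: N_def)
    \<comment> \<open>The integration constant \<open>d\<close> need not be determined: uniqueness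
      tolerates a constant factor.\<close>
    show "real_exp_moment P 0 s = exp d * real_exp_moment N 0 s" if s: "s \<in> nat_params" for s
    proof -
      have "cgf P s = d + (b * s + w * s\<^sup>2 / 2)" using d[OF s] by simp
      thus ?thesis
        using exp_cgf[OF prob_P sets_P nat_params_subset[OF s]] by (simp add: N exp_add)
    qed
  qed (use interior_nonempty interior_subset in \<open>auto simp: N(1)\<close>)
  \<comment> \<open>The cumulant function of a normal law is finite everywhere, so the affine mean
    map of slope \<open>w > 0\<close> is defined on the whole line and is onto.\<close>
  hence UNIV: "nat_params = UNIV" by (simp add: N(1))
  have "y = tilt_mean P ((y - b) / w)" for y
    using mean[of "(y - b) / w"] w by (simp add: UNIV)
  thus "means = UNIV" unfolding UNIV by blast
qed

end

text \<open>A single negative point can be dilated below any given real number, and order convexity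
  fills the gap up to the positive half-line. Without one, only the point 0 remains undecided, and
  it is not interior.\<close>

lemma family_domain_reals:
  assumes "family_domain Obar"
  shows "domain_interior Obar = UNIV \<or> domain_interior Obar = {0<..}"
proof -
  let ?S = "{x. ereal x \<in> Obar}"
  have pos: "x \<in> ?S" if "x > 0" for x
    using assms that by (auto simp: family_domain_def)
  show ?thesis
  proof (cases "?S \<subseteq> {0..}")
    case True
    have "{0<..} \<subseteq> ?S" using pos by auto
    hence "{0<..} \<subseteq> interior ?S" by (rule interior_maximal) simp
    moreover have "interior ?S \<subseteq> {0<..}" using interior_mono[OF True] by simp
    ultimately show ?thesis by (simp add: domain_interior_def)
  next
    case False
    then obtain x where x: "ereal x \<in> Obar" "x < 0" by force
    have "y \<in> ?S" for y
    proof (cases "y > 0")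
      case False
      \<comment> \<open>The dilation that moves the negative point \<open>x\<close> to
        \<open>y - 1\<close>, which lies below \<open>y\<close>.\<close>
      define c where "c = (y - 1) / x"
      have c: "c > 0" "c * x = y - 1" using x(2) False by (auto simp: c_def divide_neg_neg)
      have "ereal c * ereal x \<in> Obar" using assms x c(1) unfolding family_domain_def by blast
      hence "ereal (y - 1) \<in> Obar" using c(2) by simp
      moreover have "ereal 1 \<in> Obar" using pos[of 1] by simp
      ultimately have "{ereal (y - 1)..ereal 1} \<subseteq> Obar"
        using assms unfolding family_domain_def by blast
      thus ?thesis using False by auto
    qed (use pos in auto)
    thus ?thesis by (auto simp: domain_interior_def)
  qed
qed

section \<open>Exponential families of Levy processes\<close>

locale exp_levy_family = exp_family_generator P for P :: "real measure" +
  fixes M :: "'a measure" and Obar :: "ereal set" and X :: "ereal \<Rightarrow> real \<Rightarrow> 'a \<Rightarrow> real"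
  assumes prob_M: "prob_space M"
    and levy: "\<And>\<mu>. \<mu> \<in> Obar \<Longrightarrow> levy_process M (X \<mu>)"
    and Obar: "Obar = cgf_deriv P ` cgf_domain P"
    and law: "\<And>\<theta>. \<theta> \<in> cgf_domain P \<Longrightarrow> distr M borel (X (cgf_deriv P \<theta>) 1) = exp_tilt P \<theta>"
begin

lemma levy_param: "\<theta> \<in> cgf_domain P \<Longrightarrow> levy_process M (X (cgf_deriv P \<theta>))"
  using levy by (simp add: Obar)

text \<open>At time 1 the law is a tilt of \<open>P\<close>, whose moment generating function is a
  quotient of two values of that of \<open>P\<close>; a general time enters as a power. Here
  \<theta> may be an endpoint of the domain.\<close>

lemma mgf_family:
  assumes \<theta>: "\<theta> \<in> cgf_domain P" and s: "\<theta> + s \<in> cgf_domain P" and t: "t \<ge> 0"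
  shows "integrable M (\<lambda>\<omega>. exp (s * X (cgf_deriv P \<theta>) t \<omega>))"
    and "(\<integral>\<omega>. exp (s * X (cgf_deriv P \<theta>) t \<omega>) \<partial>M) = exp (t * (cgf P (\<theta> + s) - cgf P \<theta>))"
proof -
  let ?Y = "X (cgf_deriv P \<theta>)"
  have [measurable]: "?Y 1 \<in> borel_measurable M"
    by (rule levy_measurable[OF prob_M levy_param[OF \<theta>]]) simp
  have "s \<in> cgf_domain (distr M borel (?Y 1))"
    unfolding law[OF \<theta>] cgf_domain_exp_tilt[OF sets_P] by (rule s)
  hence int: "integrable M (\<lambda>\<omega>. exp (s * ?Y 1 \<omega>))"
    unfolding cgf_domain_def mem_Collect_eq by (subst (asm) integrable_distr_eq) auto
  have "(\<integral>\<omega>. exp (s * ?Y 1 \<omega>) \<partial>M) = real_exp_moment (distr M borel (?Y 1)) 0 s"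
    unfolding real_exp_moment_def by (subst integral_distr) auto
  also have "\<dots> = exp (cgf P (\<theta> + s) - cgf P \<theta>)"
    unfolding law[OF \<theta>] real_exp_moment_exp_tilt[OF sets_P] exp_cgf[OF prob_P sets_P s, symmetric]
    by (simp add: mult_exp_exp)
  finally have 1: "(\<integral>\<omega>. exp (s * ?Y 1 \<omega>) \<partial>M) = exp (cgf P (\<theta> + s) - cgf P \<theta>)" .
  show "integrable M (\<lambda>\<omega>. exp (s * ?Y t \<omega>))"
    by (rule levy_mgf(1)[OF prob_M levy_param[OF \<theta>] t int])
  show "(\<integral>\<omega>. exp (s * ?Y t \<omega>) \<partial>M) = exp (t * (cgf P (\<theta> + s) - cgf P \<theta>))"
    using levy_mgf(2)[OF prob_M levy_param[OF \<theta>] t int] by (simp add: 1 powr_def)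
qed

lemma domain_interior_Obar: "domain_interior Obar = means"
  unfolding Obar by (rule domain_interior_eq_means)

lemma variance_function_eq:
  assumes \<theta>: "\<theta> \<in> nat_params"
  shows "variance_function M X (tilt_mean P \<theta>) = tilt_variance P \<theta>"
proof -
  let ?Z = "X (ereal (tilt_mean P \<theta>)) 1"
  have eq: "cgf_deriv P \<theta> = ereal (tilt_mean P \<theta>)" by (rule cgf_deriv_interior[OF \<theta>])
  have [measurable]: "?Z \<in> borel_measurable M"
    using levy_measurable[OF prob_M levy_param[OF nat_params_subset[OF \<theta>]], of 1] by (simp add: eq)
  have D: "distr M borel ?Z = exp_tilt P \<theta>"
    using law[OF nat_params_subset[OF \<theta>]] by (simp add: eq)
  have "(\<integral>x. (x - (\<integral>x. x \<partial>distr M borel ?Z))\<^sup>2 \<partial>distr M borel ?Z)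
      = (\<integral>\<omega>. (?Z \<omega> - (\<integral>\<omega>. ?Z \<omega> \<partial>M))\<^sup>2 \<partial>M)"
    by (simp add: integral_distr)
  thus ?thesis
    using variance_exp_tilt(1)[OF prob_P sets_P \<theta>] by (simp add: variance_function_def D)
qed

section \<open>From homogeneous variance to self-similarity\<close>

lemma hom_imp_self_similar:
  assumes H: "(H - 1) * (p - 2) = 1" "(H - 1) * (p - 1) = H"
    and scale: "\<And>\<mu> a. \<mu> \<in> means \<Longrightarrow> a > 0 \<Longrightarrow> a * \<mu> \<in> means"
    and hom: "\<And>\<theta> \<theta>' a. \<theta> \<in> nat_params \<Longrightarrow> \<theta>' \<in> nat_params \<Longrightarrow> a > 0
      \<Longrightarrow> tilt_mean P \<theta>' = a * tilt_mean P \<theta> \<Longrightarrow> tilt_variance P \<theta>' = a powr p * tilt_variance P \<theta>"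
  shows "self_similar M Obar X H"
  unfolding self_similar_def
proof (intro allI impI ballI)
  fix c :: real and \<mu> assume c: "c > 0" and \<mu>: "\<mu> \<in> Obar"
  obtain \<theta> where \<theta>: "\<theta> \<in> cgf_domain P" "\<mu> = cgf_deriv P \<theta>" using \<mu> by (auto simp: Obar)
  define a where "a = c powr (H - 1)"
  \<comment> \<open>The slope of the affine parameter map, forced by
    \<open>a powr p * r = a\<close>.\<close>
  define r where "r = a powr (1 - p)"
  have a: "a > 0" and r: "r > 0" using c by (auto simp: a_def r_def)
  \<comment> \<open>The two conditions on \<open>H\<close> enter through two identities. This one
    matches the argument shift \<open>s\<close> at \<open>\<theta>'\<close> with
    \<open>c powr H * s\<close> at \<theta>; \<open>cra\<close> below makes the coefficients of the
    two cumulant functions equal.\<close>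
  have cH: "c powr H * r = 1"
  proof -
    have "H + (H - 1) * (1 - p) = 0" using H(2) by (simp add: algebra_simps)
    thus ?thesis using c by (simp add: a_def r_def powr_powr flip: powr_add)
  qed
  have cra: "c * (r * a) = 1"
  proof -
    have "c * (r * a) = c powr 1 * (c powr ((H - 1) * (1 - p)) * c powr (H - 1))"
      using c by (simp add: a_def r_def powr_powr)
    also have "\<dots> = c powr (1 + ((H - 1) * (1 - p) + (H - 1)))"
      by (simp only: powr_add)
    also have "1 + ((H - 1) * (1 - p) + (H - 1)) = 0" using H(1) by (simp add: algebra_simps)
    finally show ?thesis using c by simp
  qed
  have scale': "\<mu> / a \<in> means" if "\<mu> \<in> means" for \<mu>
    using scale[OF that, of "inverse a"] a by (simp add: divide_inverse mult.commute)
  have hom': "tilt_variance P \<theta>' * r = a * tilt_variance P \<theta>"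
    if "\<theta> \<in> nat_params" "\<theta>' \<in> nat_params" "tilt_mean P \<theta>' = a * tilt_mean P \<theta>" for \<theta> \<theta>'
  proof -
    have "a powr p * r = a" using a by (simp add: r_def flip: powr_add)
    thus ?thesis using hom[OF that(1,2) a that(3)] by (simp add: mult_ac)
  qed
  obtain b d where onto: "(\<lambda>\<theta>. r * \<theta> + b) ` nat_params = nat_params"
    and mean: "\<And>\<theta>. \<theta> \<in> nat_params \<Longrightarrow> tilt_mean P (r * \<theta> + b) = a * tilt_mean P \<theta>"
    and cgf: "\<And>\<theta>. \<theta> \<in> nat_params \<Longrightarrow> cgf P (r * \<theta> + b) = r * a * cgf P \<theta> + d"
    using affine_scaling[OF a r scale[OF _ a] scale' hom'] by blast
  define \<theta>' where "\<theta>' = r * \<theta> + b"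
  have \<theta>': "\<theta>' \<in> cgf_domain P" "cgf_deriv P \<theta>' = \<mu> * ereal a"
    using affine_scaling_cgf_deriv[OF a r onto mean \<theta>(1)] by (auto simp: \<theta>'_def \<theta>(2))
  have Y: "levy_process M (\<lambda>t. X (\<mu> * ereal a) (c * t))"
    using levy_process_time_change[OF prob_M levy_param[OF \<theta>'(1)] c] by (simp add: \<theta>'(2))
  have Z: "levy_process M (\<lambda>t \<omega>. c powr H * X \<mu> t \<omega>)"
    using levy_process_scale[OF prob_M levy_param[OF \<theta>(1)], of "c powr H"] c by (simp add: \<theta>(2))
  show "same_fdd M (\<lambda>t. X (\<mu> * ereal (c powr (H - 1))) (c * t)) (\<lambda>t \<omega>. c powr H * X \<mu> t \<omega>)"
    unfolding a_def[symmetric]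
  proof (rule levy_same_fdd[OF prob_M Y Z])
    fix t :: real assume t: "t \<ge> 0"
    have meas [measurable]: "X (\<mu> * ereal a) (c * t) \<in> borel_measurable M"
        "(\<lambda>\<omega>. c powr H * X \<mu> t \<omega>) \<in> borel_measurable M"
      by (fact levy_measurable[OF prob_M Y t] levy_measurable[OF prob_M Z t])+
    \<comment> \<open>When \<theta> is an endpoint, 0 is not in \<open>U\<close>. This is harmless,
      since proportionality on any nonempty open set determines the law.\<close>
    define U where "U = (\<lambda>s. \<theta> + c powr H * s) -` nat_params"
    have U: "\<theta> + c powr H * s \<in> nat_params" "\<theta>' + s = r * (\<theta> + c powr H * s) + b"
        "\<theta>' + s \<in> nat_params" if "s \<in> U" for s
    proof -
      show 1: "\<theta> + c powr H * s \<in> nat_params" using that by (simp add: U_def)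
      show 2: "\<theta>' + s = r * (\<theta> + c powr H * s) + b"
        using cH by (simp add: \<theta>'_def algebra_simps)
      show "\<theta>' + s \<in> nat_params" unfolding 2 using onto 1 by blast
    qed
    have mgfY: "integrable M (\<lambda>\<omega>. exp (s * X (\<mu> * ereal a) (c * t) \<omega>))"
        "(\<integral>\<omega>. exp (s * X (\<mu> * ereal a) (c * t) \<omega>) \<partial>M) = exp (c * t * (cgf P (\<theta>' + s) - cgf P \<theta>'))"
      if "s \<in> U" for s
      using mgf_family[OF \<theta>'(1) nat_params_subset[OF U(3)[OF that]], of "c * t"] c t
      by (simp_all add: \<theta>'(2))
    have mgfZ: "integrable M (\<lambda>\<omega>. exp (s * (c powr H * X \<mu> t \<omega>)))"
        "(\<integral>\<omega>. exp (s * (c powr H * X \<mu> t \<omega>)) \<partial>M) = exp (t * (cgf P (\<theta> + c powr H * s) - cgf P \<theta>))"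
      if "s \<in> U" for s
      using mgf_family[OF \<theta>(1) nat_params_subset[OF U(1)[OF that]] t]
      by (simp_all add: \<theta>(2)[symmetric] mult_ac)
    show "distr M borel (X (\<mu> * ereal a) (c * t)) = distr M borel (\<lambda>\<omega>. c powr H * X \<mu> t \<omega>)"
    proof (rule exp_moment_unique)
      show "open U" unfolding U_def by (intro open_vimage continuous_intros) auto
      obtain \<theta>0 where "\<theta>0 \<in> nat_params" using interior_nonempty by blast
      hence "(\<theta>0 - \<theta>) / c powr H \<in> U" using c by (simp add: U_def)
      thus "U \<noteq> {}" by blast
      show "U \<subseteq> cgf_domain (distr M borel (X (\<mu> * ereal a) (c * t)))"
        unfolding cgf_domain_def
        by (intro subsetI CollectI, subst integrable_distr_eq[OF meas(1)])
          (measurable, rule mgfY(1))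
      show "U \<subseteq> cgf_domain (distr M borel (\<lambda>\<omega>. c powr H * X \<mu> t \<omega>))"
        unfolding cgf_domain_def
        by (intro subsetI CollectI, subst integrable_distr_eq[OF meas(2)])
          (measurable, rule mgfZ(1))
      fix s assume s: "s \<in> U"
      \<comment> \<open>The relation \<open>cgf\<close> is available only at interior parameters, so
        it is applied at the shifted points. The terms free of \<open>s\<close>, among them the
        values at \<open>\<theta>\<close> and \<open>\<theta>'\<close>, go into the constant of
        proportionality.\<close>
      have "c * t * (cgf P (\<theta>' + s) - cgf P \<theta>')
          = t * (c * (r * a)) * cgf P (\<theta> + c powr H * s) + c * t * (d - cgf P \<theta>')"
        unfolding U(2)[OF s] cgf[OF U(1)[OF s]] by (simp add: algebra_simps)
      also have "\<dots> = c * t * (d - cgf P \<theta>') + t * cgf P \<theta> + t * (cgf P (\<theta> + c powr H * s) - cgf P \<theta>)"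
        unfolding cra by (simp add: algebra_simps)
      finally have "exp (c * t * (cgf P (\<theta>' + s) - cgf P \<theta>'))
          = exp (c * t * (d - cgf P \<theta>') + t * cgf P \<theta>) * exp (t * (cgf P (\<theta> + c powr H * s) - cgf P \<theta>))"
        by (simp only: exp_add)
      thus "real_exp_moment (distr M borel (X (\<mu> * ereal a) (c * t))) 0 s
        = exp (c * t * (d - cgf P \<theta>') + t * cgf P \<theta>)
          * real_exp_moment (distr M borel (\<lambda>\<omega>. c powr H * X \<mu> t \<omega>)) 0 s"
        unfolding real_exp_moment_def
        by (subst integral_distr[OF meas(1)], measurable, subst integral_distr[OF meas(2)], measurable)
          (simp only: power_0 mult_1 mgfY(2)[OF s] mgfZ(2)[OF s])
    qed (simp_all only: prob_space.prob_space_distr[OF prob_M] meas sets_distr)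
  qed
qed

section \<open>From self-similarity to homogeneous variance\<close>

lemma self_similar_imp_hom:
  assumes H: "(H - 1) * (p - 2) = 1" "(H - 1) * p = 2 * H - 1"
    and ss: "self_similar M Obar X H"
    and \<theta>: "\<theta> \<in> nat_params" "\<theta>' \<in> nat_params" and a: "a > 0"
    and mean: "tilt_mean P \<theta>' = a * tilt_mean P \<theta>"
  shows "tilt_variance P \<theta>' = a powr p * tilt_variance P \<theta>"
proof -
  \<comment> \<open>Because \<open>(H - 1) * (p - 2) = 1\<close>, this is the time scale whose mean
    factor \<open>c powr (H - 1)\<close> is \<open>a\<close>.\<close>
  define c where "c = a powr (p - 2)"
  have c: "c > 0" using a by (simp add: c_def)
  have ca: "c powr (H - 1) = a" using a H(1) by (simp add: c_def powr_powr mult.commute)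
  have c2: "c powr (2 * H - 1) = a powr p"
  proof -
    have "(p - 2) * ((H - 1) * p) = ((H - 1) * (p - 2)) * p" by (simp add: algebra_simps)
    hence "(p - 2) * ((H - 1) * p) = p" by (simp only: H(1) mult_1)
    thus ?thesis by (simp only: c_def powr_powr H(2)[symmetric])
  qed
  define k where "k = c powr H"
  let ?\<mu> = "cgf_deriv P \<theta>"
  have \<mu>_in: "?\<mu> \<in> Obar"
    using nat_params_subset[OF \<theta>(1)] by (simp add: Obar)
  have \<mu>_scaled: "?\<mu> * ereal a = cgf_deriv P \<theta>'"
    using mean by (simp add: cgf_deriv_interior[OF \<theta>(1)] cgf_deriv_interior[OF \<theta>(2)] mult.commute)
  note dom = nat_params_subset[OF \<theta>(1)] nat_params_subset[OF \<theta>(2)]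
  have [measurable]: "X ?\<mu> t \<in> borel_measurable M" "X (cgf_deriv P \<theta>') t \<in> borel_measurable M"
    if "t \<ge> 0" for t
    using levy_measurable[OF prob_M levy_param that] dom by auto
  have law_eq: "distr M borel (X (cgf_deriv P \<theta>') c) = distr M borel (\<lambda>\<omega>. k * X ?\<mu> 1 \<omega>)"
  proof -
    \<comment> \<open>Equality of one marginal suffices: the singleton vector at time 1 is projected
      to its only coordinate.\<close>
    let ?J = "{1::real}"
    have "distr M (Pi\<^sub>M ?J (\<lambda>_. borel)) (\<lambda>\<omega>. \<lambda>t\<in>?J. X (cgf_deriv P \<theta>') (c * t) \<omega>)
        = distr M (Pi\<^sub>M ?J (\<lambda>_. borel)) (\<lambda>\<omega>. \<lambda>t\<in>?J. k * X ?\<mu> t \<omega>)"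
      using ss[unfolded self_similar_def same_fdd_def, rule_format, OF c \<mu>_in, of ?J]
      by (simp add: ca \<mu>_scaled k_def)
    hence "distr (distr M (Pi\<^sub>M ?J (\<lambda>_. borel)) (\<lambda>\<omega>. \<lambda>t\<in>?J. X (cgf_deriv P \<theta>') (c * t) \<omega>)) borel (\<lambda>f. f 1)
        = distr (distr M (Pi\<^sub>M ?J (\<lambda>_. borel)) (\<lambda>\<omega>. \<lambda>t\<in>?J. k * X ?\<mu> t \<omega>)) borel (\<lambda>f. f 1)"
      by simp
    thus ?thesis
      using c by (subst (asm) (1 2) distr_distr) (auto simp: comp_def intro!: measurable_restrict)
  qed
  define U where "U = (\<lambda>s. \<theta> + k * s) -` nat_params \<inter> (\<lambda>s. \<theta>' + s) -` nat_params"
  have "open U" unfolding U_def by (intro open_Int open_vimage continuous_intros) auto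
  have "0 \<in> U" using \<theta> by (simp add: U_def)
  have U: "\<theta> + k * s \<in> nat_params" "\<theta>' + s \<in> nat_params" if "s \<in> U" for s
    using that by (auto simp: U_def)
  \<comment> \<open>Both sides are logarithms of the moment generating function of the common law.
    The identity holds on a neighbourhood of 0, so it can be differentiated there twice.\<close>
  have cgf_eq: "c * (cgf P (\<theta>' + s) - cgf P \<theta>') = cgf P (\<theta> + k * s) - cgf P \<theta>" if s: "s \<in> U" for s
  proof -
    have "exp (c * (cgf P (\<theta>' + s) - cgf P \<theta>')) = (\<integral>\<omega>. exp (s * X (cgf_deriv P \<theta>') c \<omega>) \<partial>M)"
      using mgf_family(2)[OF dom(2) nat_params_subset[OF U(2)[OF s]], of c] c by simp
    also have "\<dots> = (\<integral>x. exp (s * x) \<partial>distr M borel (X (cgf_deriv P \<theta>') c))"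
      using c by (subst integral_distr) auto
    also have "\<dots> = (\<integral>\<omega>. exp (s * (k * X ?\<mu> 1 \<omega>)) \<partial>M)"
      unfolding law_eq by (subst integral_distr) auto
    also have "\<dots> = exp (cgf P (\<theta> + k * s) - cgf P \<theta>)"
      using mgf_family(2)[OF dom(1) nat_params_subset[OF U(1)[OF s]], of 1] by (simp add: mult_ac)
    finally show ?thesis by simp
  qed
  have mean_eq: "c * tilt_mean P (\<theta>' + s) = k * tilt_mean P (\<theta> + k * s)" if s: "s \<in> U" for s
  proof -
    have "((\<lambda>s. c * (cgf P (\<theta>' + s) - cgf P \<theta>')) has_field_derivative c * (tilt_mean P (\<theta>' + s) * 1)) (at s)"
      using DERIV_cmult[OF DERIV_diff[OF DERIV_compose_affine[of "cgf P" _ \<theta>' 1 s] DERIV_const]]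
        DERIV_cgf[OF U(2)[OF s]] by simp
    hence 1: "((\<lambda>s. cgf P (\<theta> + k * s) - cgf P \<theta>) has_field_derivative c * (tilt_mean P (\<theta>' + s) * 1)) (at s)"
      by (rule has_field_derivative_transform_within_open[OF _ \<open>open U\<close> s]) (rule cgf_eq)
    have "((\<lambda>s. cgf P (\<theta> + k * s) - cgf P \<theta>) has_field_derivative tilt_mean P (\<theta> + k * s) * k) (at s)"
      using DERIV_diff[OF DERIV_compose_affine[OF DERIV_cgf[OF U(1)[OF s]]] DERIV_const] by simp
    from DERIV_unique[OF 1 this] show ?thesis by (simp add: mult.commute)
  qed
  have "((\<lambda>s. c * tilt_mean P (\<theta>' + s)) has_field_derivative c * (tilt_variance P \<theta>' * 1)) (at 0)"
    using DERIV_compose_affine[of "tilt_mean P" _ \<theta>' 1 0] DERIV_mean[OF \<theta>(2)] by (intro DERIV_cmult) simp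
  hence 1: "((\<lambda>s. k * tilt_mean P (\<theta> + k * s)) has_field_derivative c * (tilt_variance P \<theta>' * 1)) (at 0)"
    by (rule has_field_derivative_transform_within_open[OF _ \<open>open U\<close> \<open>0 \<in> U\<close>]) (rule mean_eq)
  have "((\<lambda>s. k * tilt_mean P (\<theta> + k * s)) has_field_derivative k * (tilt_variance P \<theta> * k)) (at 0)"
    using DERIV_mean[OF \<theta>(1)] by (intro DERIV_cmult DERIV_compose_affine) simp
  from DERIV_unique[OF 1 this] have "c * tilt_variance P \<theta>' = k\<^sup>2 * tilt_variance P \<theta>"
    by (simp add: power2_eq_square mult_ac)
  \<comment> \<open>Cancelling one factor \<open>c\<close> leaves \<open>c powr (2 * H - 1)\<close>,
    which is \<open>a powr p\<close> by \<open>c2\<close>.\<close>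
  moreover have "k\<^sup>2 = c * c powr (2 * H - 1)"
  proof -
    have "k\<^sup>2 = c powr (2 * H)" using c by (simp add: k_def power2_eq_square flip: powr_add)
    also have "\<dots> = c powr 1 * c powr (2 * H - 1)" by (subst powr_add[symmetric]) simp
    finally show ?thesis using c by simp
  qed
  ultimately show ?thesis using c by (simp add: c2)
qed

end

section \<open>Arithmetic of the Hurst exponent\<close>

lemma hurst_exponent_eq:
  assumes "p \<noteq> 2"
  shows "hurst_exponent p = (1 - p) / (2 - p)"
proof (cases "p = 1")
  case True
  thus ?thesis by (simp add: hurst_exponent_def stability_index_def)
next
  case False
  have "1 + inverse (1 - p) = (2 - p) / (1 - p)"
    using False by (simp add: field_simps)
  moreover have "(2 - p) / (1 - p) \<noteq> 0" using False assms by simp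
  ultimately show ?thesis
    using False by (simp add: hurst_exponent_def stability_index_def one_ereal_def divide_ereal_def)
qed

text \<open>Three division-free forms of \<open>H * (2 - p) = 1 - p\<close>, in the shapes in which
  exponents of \<open>powr\<close> are combined above.\<close>

lemma hurst_exponent_identities:
  assumes "p \<noteq> 2"
  defines "H \<equiv> hurst_exponent p"
  shows "(H - 1) * (p - 2) = 1" "(H - 1) * (p - 1) = H" "(H - 1) * p = 2 * H - 1"
proof -
  have "H * (2 - p) = 1 - p"
    using assms by (simp add: hurst_exponent_eq)
  hence *: "H * p = 2 * H + p - 1" by (simp add: algebra_simps)
  show "(H - 1) * (p - 2) = 1" "(H - 1) * (p - 1) = H" "(H - 1) * p = 2 * H - 1"
    using * by (simp_all add: algebra_simps)
qed

section \<open>Power variance and self-similarity\<close>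

context exp_levy_family
begin

lemma power_variance_imp_self_similar:
  assumes p: "p \<noteq> 2" and pv: "power_variance M Obar X p"
  shows "self_similar M Obar X (hurst_exponent p)"
proof -
  have means: "means = (if p = 0 then UNIV else {0<..})"
    using pv by (simp add: power_variance_def domain_interior_Obar)
  obtain \<sigma>2 where \<sigma>2: "\<And>\<mu>. \<mu> \<in> means
      \<Longrightarrow> variance_function M X \<mu> = \<sigma>2 * (if p = 0 then 1 else \<mu> powr p)"
    using pv unfolding power_variance_def domain_interior_Obar by blast
  have var: "tilt_variance P \<theta> = \<sigma>2 * (if p = 0 then 1 else tilt_mean P \<theta> powr p)"
    if "\<theta> \<in> nat_params" for \<theta>
    using \<sigma>2[of "tilt_mean P \<theta>"] variance_function_eq[OF that] that by simp
  show ?thesis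
  proof (rule hom_imp_self_similar[OF hurst_exponent_identities(1,2)[OF p]])
    show "a * \<mu> \<in> means" if "\<mu> \<in> means" "a > 0" for \<mu> a
      using that unfolding means by (auto split: if_splits)
    show "tilt_variance P \<theta>' = a powr p * tilt_variance P \<theta>"
      if "\<theta> \<in> nat_params" "\<theta>' \<in> nat_params" "a > 0" "tilt_mean P \<theta>' = a * tilt_mean P \<theta>" for \<theta> \<theta>' a
    proof (cases "p = 0")
      case True
      thus ?thesis using that by (simp add: var)
    next
      case False
      have "tilt_mean P \<theta> \<in> means" using that(1) by blast
      hence "tilt_mean P \<theta> > 0" using False by (simp add: means)
      thus ?thesis using that False by (simp add: var powr_mult)
    qed
  qed
qed

text \<open>Used with the left and right filters at the parameter of mean 0: no positive dilation
  reaches that mean from another one, so its variance is obtained by continuity.\<close>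

lemma constant_limit_variance:
  assumes \<theta>: "\<theta> \<in> nat_params" and F: "F \<le> at \<theta>" "F \<noteq> bot"
    and const: "\<forall>\<^sub>F s in F. s \<in> nat_params \<longrightarrow> tilt_variance P s = w"
  shows "tilt_variance P \<theta> = w"
proof -
  have "(tilt_variance P \<longlongrightarrow> tilt_variance P \<theta>) F"
    using continuous_tilt_variance[OF prob_P sets_P \<theta>] tendsto_mono[OF F(1)] by (auto simp: isCont_def)
  moreover have "\<forall>\<^sub>F s in F. s \<in> nat_params"
    using eventually_at_in_open'[OF open_interior \<theta>] F(1) by (rule filter_leD[rotated])
  with const have "\<forall>\<^sub>F s in F. tilt_variance P s = w" by eventually_elim simp
  hence "(tilt_variance P \<longlongrightarrow> w) F" by (rule tendsto_eventually)
  ultimately show ?thesis by (rule tendsto_unique[OF F(2)])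
qed

lemma self_similar_imp_power_variance:
  assumes p: "p \<noteq> 2" and dom: "family_domain Obar"
    and ss: "self_similar M Obar X (hurst_exponent p)"
  shows "power_variance M Obar X p"
proof -
  have hom: "tilt_variance P \<theta>' = a powr p * tilt_variance P \<theta>"
    if "\<theta> \<in> nat_params" "\<theta>' \<in> nat_params" "a > 0" "tilt_mean P \<theta>' = a * tilt_mean P \<theta>" for \<theta> \<theta>' a
    using self_similar_imp_hom[OF hurst_exponent_identities(1,3)[OF p] ss that] .
  have cases: "means = UNIV \<or> means = {0<..}"
    using family_domain_reals[OF dom] by (simp add: domain_interior_Obar)
  \<comment> \<open>The mean 1 is the reference point: every positive mean is a dilation of it, so
    \<open>w\<close> fixes the variance on the positive half-line.\<close>
  hence "1 \<in> means" by auto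
  then obtain \<theta>1 where \<theta>1: "\<theta>1 \<in> nat_params" "tilt_mean P \<theta>1 = 1" by force
  define w where "w = tilt_variance P \<theta>1"
  have w: "w > 0" unfolding w_def by (rule variance_pos[OF \<theta>1(1)])
  have pos: "tilt_variance P \<theta> = tilt_mean P \<theta> powr p * w" if "\<theta> \<in> nat_params" "tilt_mean P \<theta> > 0" for \<theta>
    unfolding w_def using that \<theta>1 by (intro hom) auto
  have var: "means = (if p = 0 then UNIV else {0<..}) \<and>
      (\<forall>\<theta>\<in>nat_params. tilt_variance P \<theta> = w * (if p = 0 then 1 else tilt_mean P \<theta> powr p))"
    using cases
  proof
    assume means: "means = {0<..}"
    hence mean_pos: "tilt_mean P \<theta> > 0" if "\<theta> \<in> nat_params" for \<theta>
      using that by blast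
    \<comment> \<open>A constant variance would make the law Gaussian, and then every real number
      would be a mean.\<close>
    have "p \<noteq> 0"
    proof
      assume "p = 0"
      hence "means = UNIV"
        using pos mean_pos by (intro constant_variance_means[OF w]) force
      thus False using means by (metis UNIV_I greaterThan_iff less_irrefl)
    qed
    thus ?thesis using means pos mean_pos by (simp add: mult.commute)
  next
    assume means: "means = UNIV"
    then obtain \<theta>0 \<theta>2 where \<theta>0: "\<theta>0 \<in> nat_params" "tilt_mean P \<theta>0 = 0"
      and \<theta>2: "\<theta>2 \<in> nat_params" "tilt_mean P \<theta>2 = - 1"
      by (metis UNIV_I imageE)
    \<comment> \<open>The mean 0 is fixed by dilation, so homogeneity with \<open>a = 2\<close>
      compares its positive variance with itself and forces \<open>p = 0\<close>.\<close>
    have "tilt_variance P \<theta>0 = 2 powr p * tilt_variance P \<theta>0"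
      using \<theta>0 by (intro hom) auto
    hence "2 powr p = 2 powr 0" using variance_pos[OF \<theta>0(1)] by simp
    hence p0: "p = 0" by (subst (asm) powr_inj) auto
    \<comment> \<open>Dilations keep the sign of the mean, so for \<open>p = 0\<close> the variance
      is constant on each side of \<open>\<theta>0\<close>, possibly with different values.
      Continuity at \<open>\<theta>0\<close> identifies the two constants.\<close>
    have right: "tilt_variance P \<theta> = w" if "\<theta> \<in> nat_params" "\<theta> > \<theta>0" for \<theta>
      using mean_strict_mono[OF \<theta>0(1) that] pos[OF that(1)] \<theta>0(2) by (simp add: p0)
    have left: "tilt_variance P \<theta> = tilt_variance P \<theta>2" if "\<theta> \<in> nat_params" "\<theta> < \<theta>0" for \<theta>
      using mean_strict_mono[OF that(1) \<theta>0(1) that(2)] hom[OF \<theta>2(1) that(1), of "- tilt_mean P \<theta>"] \<theta>0(2) \<theta>2(2)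
      by (simp add: p0)
    have "tilt_variance P \<theta>0 = w"
      using right by (intro constant_limit_variance[OF \<theta>0(1), of "at_right \<theta>0"])
        (auto simp: at_le eventually_at_filter)
    moreover have "tilt_variance P \<theta>0 = tilt_variance P \<theta>2"
      using left by (intro constant_limit_variance[OF \<theta>0(1), of "at_left \<theta>0"])
        (auto simp: at_le eventually_at_filter)
    ultimately have "tilt_variance P \<theta> = w" if "\<theta> \<in> nat_params" for \<theta>
      using left[OF that] right[OF that] by (cases \<theta> \<theta>0 rule: linorder_cases) auto
    thus ?thesis using p0 means by simp
  qed
  have "variance_function M X \<mu> = w * (if p = 0 then 1 else \<mu> powr p)" if \<mu>: "\<mu> \<in> means" for \<mu>
  proof -
    obtain \<theta> where "\<theta> \<in> nat_params" "\<mu> = tilt_mean P \<theta>" using \<mu> by blast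
    thus ?thesis using var variance_function_eq by simp
  qed
  thus ?thesis
    unfolding power_variance_def domain_interior_Obar using var w by blast
qed

end

theorem theorem3p1:
  fixes M :: "'a measure" and Obar :: "ereal set"
    and X :: "ereal \<Rightarrow> real \<Rightarrow> 'a \<Rightarrow> real" and p :: real
  assumes "prob_space M"
    and "family_domain Obar"
    and "exponential_levy_family M Obar X"
    and "p \<in> UNIV - {0<..<1}" and "p \<noteq> 2"
  shows "(self_similar M Obar X (hurst_exponent p) \<longleftrightarrow> power_variance M Obar X p) \<and>
         (self_similar M Obar X (hurst_exponent p) \<longleftrightarrow> hougaard_family M Obar X p)"
proof -
  obtain P where P: "prob_space P" "sets P = sets borel" "\<not> (\<exists>a. AE x in P. x = a)"
      "interior (cgf_domain P) \<noteq> {}" "Obar = cgf_deriv P ` cgf_domain P"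
      "\<And>\<theta>. \<theta> \<in> cgf_domain P \<Longrightarrow> distr M borel (X (cgf_deriv P \<theta>) 1) = exp_tilt P \<theta>"
    using assms(3) unfolding exponential_levy_family_def natural_exponential_family_def exp_tilt_def
    by blast
  have levy: "\<And>\<mu>. \<mu> \<in> Obar \<Longrightarrow> levy_process M (X \<mu>)"
    using assms(3) by (simp add: exponential_levy_family_def)
  interpret exp_levy_family P M Obar X
    by (intro exp_levy_family.intro exp_family_generator.intro exp_levy_family_axioms.intro
        P(1-5) assms(1)) (fact levy P(6))+
  have "self_similar M Obar X (hurst_exponent p) \<longleftrightarrow> power_variance M Obar X p"
    using power_variance_imp_self_similar self_similar_imp_power_variance assms(2,5) by blast
  thus ?thesis using assms(3) by (simp add: hougaard_family_def)
qed

end
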